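(* Let $(X^\circ,s)$ be an $A_1$ surface singularity with minimal resolution $\tau\colon Y^\circ\to X^\circ$ and exceptional curve $E_s$ over $s$, and let $m\ge1$. Let $H$ be a hyperplane section of $X^\circ$ containing $s$. If $$\omega\in H^0\big(X^\circ-s,\ S^m\Omega^1_{X^\circ}(-\lfloor\tfrac12m\rfloor H)\big),$$ then $\tau^*\omega$ extends to a regular (symmetric) differential on the component $E_s$ of the exceptional divisor lying over $s$, i.e. $\tau^*\omega$ extends to a section of $S^m\Omega^1_{Y^\circ}$ along $E_s$.
   Context: An $A_1$ singularity is modelled by the (complex) quadric cone $x_1x_3=x_2^2$ in $\mathbb{A}^3$ with vertex $s=(0,0,0)$, with minimal resolution the blow-up of the vertex. $S^m\Omega^1$ is the $m$-th symmetric power of the cotangent sheaf. The sheaf $S^m\Omega^1_{X^\circ}(-kH)$ on $X^\circ-s$ is the subsheaf of those symmetric differentials vanishing to order at least $k$ along $H$, i.e. of the form $h^k\eta$ with $h$ a linear equation of $H$ and $\eta$ regular. *)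

theory Defs
  imports "HOL-Analysis.Analysis"
begin

section \<open>Quasi-affine varieties over the complex numbers\<close>

inductive poly_fun :: "(complex ^ 'n::finite \<Rightarrow> complex) \<Rightarrow> bool" where
  const: "poly_fun (\<lambda>x. c)"
| coord: "poly_fun (\<lambda>x. x $ i)"
| add: "poly_fun f \<Longrightarrow> poly_fun g \<Longrightarrow> poly_fun (\<lambda>x. f x + g x)"
| mult: "poly_fun f \<Longrightarrow> poly_fun g \<Longrightarrow> poly_fun (\<lambda>x. f x * g x)"

definition zariski_open :: "(complex ^ 'n::finite) set \<Rightarrow> bool" where
  "zariski_open U \<longleftrightarrow> (\<exists>F. (\<forall>f\<in>F. poly_fun f) \<and> U = {x. \<exists>f\<in>F. f x \<noteq> 0})"

definition zariski_closure :: "(complex ^ 'n::finite) set \<Rightarrow> (complex ^ 'n) set" where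
  "zariski_closure S = {x. \<forall>f. poly_fun f \<and> (\<forall>y\<in>S. f y = 0) \<longrightarrow> f x = 0}"

definition regular_on :: "(complex ^ 'n::finite) set \<Rightarrow> (complex ^ 'n \<Rightarrow> complex) \<Rightarrow> bool" where
  "regular_on V f \<longleftrightarrow>
     (\<forall>p\<in>V. \<exists>U g h. zariski_open U \<and> p \<in> U \<and> poly_fun g \<and> poly_fun h \<and>
        (\<forall>q\<in>V \<inter> U. h q \<noteq> 0 \<and> f q = g q / h q))"

text \<open>The Zariski tangent space of a locally closed \<open>V\<close> at \<open>p \<in> V\<close>. The Frechet derivative
  of a polynomial function is its complex linear differential.\<close>

definition tangent_space ::
    "(complex ^ 'n::finite) set \<Rightarrow> complex ^ 'n \<Rightarrow> (complex ^ 'n) set" where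
  "tangent_space V p =
     {v. \<forall>f. poly_fun f \<and> (\<forall>x\<in>V. f x = 0) \<longrightarrow> frechet_derivative f (at p) v = 0}"


section \<open>Symmetric differentials\<close>

text \<open>On a smooth \<open>V\<close> a section of $S^m\Omega^1_V$ is determined by its values, and its value at
  \<open>p\<close> is a form of degree \<open>m\<close> on the tangent space at \<open>p\<close>. It is represented by the function
  \<open>\<omega>\<close> of \<open>p\<close> and the tangent vector \<open>v\<close>; the values of \<open>\<omega>\<close> at other arguments are
  irrelevant, and two such functions are the same section if they agree in the sense of
  \<open>sym_diff_eq\<close>. Since $\Omega^1_V$ is generated by the differentials of the
  coordinates, the regular sections are those which locally are $\sum_\alpha a_\alpha\,dx^\alpha$
  with $a_\alpha$ regular and $|\alpha| = m$.\<close>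

type_synonym 'n sym_diff = "complex ^ 'n \<Rightarrow> complex ^ 'n \<Rightarrow> complex"

definition sym_diff_eq ::
    "(complex ^ 'n::finite) set \<Rightarrow> 'n sym_diff \<Rightarrow> 'n sym_diff \<Rightarrow> bool" where
  "sym_diff_eq V \<omega> \<eta> \<longleftrightarrow> (\<forall>p\<in>V. \<forall>v\<in>tangent_space V p. \<omega> p v = \<eta> p v)"

definition regular_sym_diff ::
    "nat \<Rightarrow> (complex ^ 'n::finite) set \<Rightarrow> 'n sym_diff \<Rightarrow> bool" where
  "regular_sym_diff m V \<omega> \<longleftrightarrow>
     (\<forall>p\<in>V. \<exists>U a. zariski_open U \<and> p \<in> U \<and>
        (\<forall>\<alpha>. regular_on (V \<inter> U) (a \<alpha>)) \<and>
        (\<forall>q\<in>V \<inter> U. \<forall>v\<in>tangent_space V q.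
           \<omega> q v = (\<Sum>\<alpha> | (\<Sum>i\<in>UNIV. \<alpha> i) = m. a \<alpha> q * (\<Prod>i\<in>UNIV. (v $ i) ^ \<alpha> i))))"

text \<open>Sections of $S^m\Omega^1_V(-kH)$, where \<open>h\<close> is an equation of \<open>H\<close>.\<close>

definition sym_diff_vanishing ::
    "nat \<Rightarrow> (complex ^ 'n::finite) set \<Rightarrow> (complex ^ 'n \<Rightarrow> complex) \<Rightarrow> nat \<Rightarrow> 'n sym_diff \<Rightarrow> bool"
  where
  "sym_diff_vanishing m V h k \<omega> \<longleftrightarrow>
     (\<exists>\<eta>. regular_sym_diff m V \<eta> \<and> sym_diff_eq V \<omega> (\<lambda>p v. h p ^ k * \<eta> p v))"

definition pullback ::
    "(complex ^ 'a::finite \<Rightarrow> complex ^ 'b::finite) \<Rightarrow> 'b sym_diff \<Rightarrow> 'a sym_diff" where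
  "pullback f \<omega> = (\<lambda>p v. \<omega> (f p) (frechet_derivative f (at p) v))"


section \<open>The blow-up of the origin\<close>

text \<open>The blow-up of \<open>V\<close> at the origin is the closure, in the product of \<open>V\<close> with a
  projective space, of the set of all $(x,[x])$ with $0 \neq x \in V$. The standard chart number
  \<open>i\<close> of the projective space consists of the points $[z]$, normalised by $z_i = 1$. So
  the corresponding open piece of the blow-up consists of pairs $(x,z)$ of vectors, which are
  encoded as vectors indexed by a sum type.\<close>

definition pair_vec :: "complex ^ 'n::finite \<Rightarrow> complex ^ 'n \<Rightarrow> complex ^ ('n + 'n)" where
  "pair_vec x z = (\<chi> k. case k of Inl i \<Rightarrow> x $ i | Inr i \<Rightarrow> z $ i)"

definition base_pt :: "complex ^ ('n::finite + 'n) \<Rightarrow> complex ^ 'n" where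
  "base_pt p = (\<chi> i. p $ Inl i)"

definition direction :: "complex ^ ('n::finite + 'n) \<Rightarrow> complex ^ 'n" where
  "direction p = (\<chi> i. p $ Inr i)"

definition blowup_chart ::
    "(complex ^ 'n::finite) set \<Rightarrow> 'n \<Rightarrow> (complex ^ ('n + 'n)) set" where
  "blowup_chart V i =
     {p \<in> zariski_closure {pair_vec x ((1 / x $ i) *s x) | x. x \<in> V \<and> x $ i \<noteq> 0}. base_pt p \<in> V}"

definition exceptional_chart ::
    "(complex ^ 'n::finite) set \<Rightarrow> 'n \<Rightarrow> (complex ^ ('n + 'n)) set" where
  "exceptional_chart V i = {p \<in> blowup_chart V i. base_pt p = 0}"

text \<open>The coordinate change to chart \<open>j\<close>, defined where \<open>direction p $ j \<noteq> 0\<close>.\<close>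

definition chart_change :: "'n \<Rightarrow> complex ^ ('n::finite + 'n) \<Rightarrow> complex ^ ('n + 'n)" where
  "chart_change j p = pair_vec (base_pt p) ((1 / direction p $ j) *s direction p)"

text \<open>A global section of $S^m\Omega^1$ on the blow-up: a family of sections on the charts that
  agree on the overlaps.\<close>

definition blowup_sym_diff ::
    "nat \<Rightarrow> (complex ^ 'n::finite) set \<Rightarrow> ('n \<Rightarrow> ('n + 'n) sym_diff) \<Rightarrow> bool" where
  "blowup_sym_diff m V \<eta> \<longleftrightarrow>
     (\<forall>i. regular_sym_diff m (blowup_chart V i) (\<eta> i)) \<and>
     (\<forall>i j. sym_diff_eq {p \<in> blowup_chart V i. direction p $ j \<noteq> 0}
        (\<eta> i) (pullback (chart_change j) (\<eta> j)))"

text \<open>In each chart the blow-down map is \<^const>\<open>base_pt\<close>.\<close>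

definition pullback_extends ::
    "nat \<Rightarrow> (complex ^ 'n::finite) set \<Rightarrow> 'n sym_diff \<Rightarrow> bool" where
  "pullback_extends m V \<omega> \<longleftrightarrow>
     (\<exists>\<eta>. blowup_sym_diff m V \<eta> \<and>
        (\<forall>i. sym_diff_eq (blowup_chart V i - exceptional_chart V i) (\<eta> i) (pullback base_pt \<omega>)))"


section \<open>The \<open>A\<^sub>1\<close> singularity\<close>

definition quadric_cone :: "(complex ^ 3) set" where
  "quadric_cone = {x. x $ 1 * x $ 3 = (x $ 2)\<^sup>2}"

text \<open>Zariski open neighbourhoods of the vertex in the cone, the cone itself included. The minimal
  resolution is the blow-up of the vertex.\<close>

definition A1_singularity :: "(complex ^ 3) set \<Rightarrow> bool" where
  "A1_singularity X \<longleftrightarrow> (\<exists>U. zariski_open U \<and> 0 \<in> U \<and> X = quadric_cone \<inter> U)"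

definition hyperplane_equation :: "(complex ^ 'n::finite \<Rightarrow> complex) \<Rightarrow> bool" where
  "hyperplane_equation h \<longleftrightarrow> (\<exists>c d. c \<noteq> 0 \<and> h = (\<lambda>x. (\<Sum>i\<in>UNIV. c $ i * x $ i) + d))"

end

theory Submission
  imports Defs "HOL-Complex_Analysis.Conformal_Mappings"
    "HOL-Computational_Algebra.Polynomial_Factorial" "HOL-Computational_Algebra.Field_as_Ring"
begin

text \<open>The cone is the quotient of the plane by \<open>\<plusminus>1\<close> via $\varphi(u,v) = (u^2,uv,v^2)$. Write
  $\omega = h^k\eta$ with $k = \lfloor m/2 \rfloor$. Away from the origin
  $\varphi^*\eta = \sum_j b_j\,du^j dv^{m-j}$; the $b_j$ are quotients of polynomials, extend over
  the origin (Hartogs) and have the parity of \<open>m\<close>, so the numerators vanish at the origin if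
  \<open>m\<close> is odd. In the chart of the blow-up with coordinates $s = u^2$, $t = v/u$ one has
  $du^j dv^{m-j} = (2u)^{-m}\,ds^j (t\,ds + 2s\,dt)^{m-j}$, while $h^k$ contributes the factor
  $s^k = u^{2k}$ and parity contributes $u^{m - 2k}$. So the pole $u^{-m}$ cancels, and what remains
  is even in \<open>u\<close>, hence regular in \<open>(s, t)\<close>.\<close>

section \<open>Polynomials in two variables and Hartogs extension\<close>

text \<open>A regular coefficient is a quotient whose numerator and denominator may change from
  point to point, so the extension over the origin is done algebraically. The ring C[v][u] is
  factorial, hence one quotient in lowest terms represents b_j on the whole punctured neighbourhood,
  and its denominator cannot vanish at the origin alone, because zeros of a polynomial in two
  complex variables are never isolated. Extension alone does not let b_j descend to s = u^2:
  numerator and denominator need a parity as polynomials, not merely as a quotient on an open set.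
  This forces a symmetrisation. Two obstacles remain on the blow-up. Tangent spaces are cut out by
  all vanishing polynomials and are never computed; only the finitely many equations of
  \<open>chart_tangent\<close> are extracted, and they suffice. And \<omega> is given only away from
  the vertex, so on the exceptional curve the agreement of the charts cannot be read off from
  \<omega>; it is obtained there by continuity.\<close>

definition eval2 :: "complex poly poly \<Rightarrow> complex \<times> complex \<Rightarrow> complex" where
  "eval2 P q = poly (poly P [:fst q:]) (snd q)"

lemma eval2_simps [simp]:
  "eval2 0 q = 0"
  "eval2 1 q = 1"
  "eval2 (P + Q) q = eval2 P q + eval2 Q q"
  "eval2 (P * Q) q = eval2 P q * eval2 Q q"
  "eval2 [:[:c:]:] q = c"
  "eval2 [:0, 1:] q = fst q"
  "eval2 [:[:0, 1:]:] q = snd q"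
  by (simp_all add: eval2_def)

lemma eval2_power [simp]: "eval2 (P ^ n) q = eval2 P q ^ n"
  by (simp add: eval2_def)

lemma eval2_pCons: "eval2 (pCons a P) q = poly a (snd q) + fst q * eval2 P q"
  by (simp add: eval2_def)

lemma eval2_compose: "\<exists>R. \<forall>q. eval2 R q = eval2 P (eval2 A q, eval2 B q)"
proof (induction P)
  case 0
  show ?case by (intro exI[of _ 0]) simp
next
  case (pCons a P)
  have "\<exists>S. \<forall>q. eval2 S q = poly a (eval2 B q)"
  proof (induction a)
    case 0
    show ?case by (intro exI[of _ 0]) simp
  next
    case (pCons c a)
    then obtain S where "\<forall>q. eval2 S q = poly a (eval2 B q)" by blast
    then show ?case by (intro exI[of _ "[:[:c:]:] + B * S"]) (simp del: pCons_eq_iff)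
  qed
  moreover from pCons obtain R where "\<forall>q. eval2 R q = eval2 P (eval2 A q, eval2 B q)" by blast
  ultimately obtain S where "\<forall>q. eval2 (S + A * R) q = eval2 (pCons a P) (eval2 A q, eval2 B q)"
    by (auto simp: eval2_pCons)
  then show ?case by blast
qed

text \<open>A nonzero \<open>P\<close> has finitely many roots in the domain C[v], whereas each of
  the infinitely many constants \<open>[:u:]\<close> would be a root.\<close>

lemma eval2_eq_0_imp:
  assumes "\<And>q. eval2 P q = 0"
  shows "P = 0"
proof (rule ccontr)
  assume "P \<noteq> 0"
  then have "finite {a. poly P a = 0}" by (rule poly_roots_finite)
  moreover have "poly P [:u:] = 0" for u
    using assms[of "(u, _)"] by (simp add: eval2_def poly_all_0_iff_0[symmetric])
  then have "range (\<lambda>u. [:u:]) \<subseteq> {a. poly P a = 0}" by auto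
  ultimately have "finite (range (\<lambda>u::complex. [:u:]))" by (rule rev_finite_subset)
  then have "finite (UNIV :: complex set)"
    by (rule finite_imageD) (simp add: inj_def)
  then show False using infinite_UNIV_char_0 by blast
qed

lemma eval2_eq_imp:
  assumes "\<And>q. eval2 P q = eval2 Q q"
  shows "P = Q"
  using eval2_eq_0_imp[of "P - Q"] assms eval2_simps(3)[of "P - Q" Q] by simp

lemma continuous_on_eval2 [continuous_intros]:
  assumes "continuous_on S f"
  shows "continuous_on S (\<lambda>x. eval2 P (f x))"
proof (induction P)
  case 0
  show ?case by simp
next
  case (pCons a P)
  then show ?case unfolding eval2_pCons by (intro continuous_intros assms) 
qed

lemma tendsto_eval2 [tendsto_intros]:
  assumes "(f \<longlongrightarrow> q) F"
  shows "((\<lambda>x. eval2 P (f x)) \<longlongrightarrow> eval2 P q) F"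
proof -
  have "isCont (eval2 P) q"
    using continuous_on_eval2[OF continuous_on_id, of UNIV P]
    by (auto simp: continuous_on_eq_continuous_at simp del: split_paired_All)
  then show ?thesis using assms by (rule isCont_tendsto_compose)
qed

lemma eval2_holomorphic: "(\<lambda>w. eval2 P (u, w)) holomorphic_on S"
proof (induction P)
  case 0
  show ?case by simp
next
  case (pCons a P)
  then show ?case unfolding eval2_pCons by (auto intro!: holomorphic_intros)
qed

text \<open>The maximum principle applied to the functions $w \mapsto 1/P(u,w)$ keeps $P(u,0)$ away
  from \<open>0\<close> if all zeros of \<open>P\<close> near the origin are excluded.\<close>

lemma eval2_zero_not_isolated:
  assumes P0: "eval2 P (0, 0) = 0" and F0: "eval2 F (0, 0) \<noteq> 0"
  obtains q where "q \<noteq> (0, 0)" "eval2 F q \<noteq> 0" "eval2 P q = 0"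
proof (rule ccontr)
  assume "\<not> thesis"
  with that have nz: "q = (0, 0) \<or> eval2 F q = 0 \<or> eval2 P q \<noteq> 0" for q by blast
  have "open {q. eval2 F q \<noteq> 0}"
    by (intro open_Collect_neq continuous_intros)
  then obtain e where e: "e > 0" "ball (0, 0) e \<subseteq> {q. eval2 F q \<noteq> 0}"
    using F0 by (metis (mono_tags, lifting) mem_Collect_eq open_contains_ball_eq)
  define r where "r = e / 3"
  have r: "r > 0" using e by (simp add: r_def)
  have box: "eval2 F (u, w) \<noteq> 0" if "norm u \<le> r" "norm w \<le> r" for u w
  proof -
    have "norm (u, w) \<le> norm u + norm w" by (rule norm_Pair_le)
    then have "norm (u, w) < e" using that e by (simp add: r_def)
    then have "(u, w) \<in> ball (0, 0) e"
      using dist_norm[of "(u, w)" "(0, 0)"] by (simp add: dist_commute)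
    then show ?thesis using e by blast
  qed
  \<comment> \<open>The circle |w| = r avoids the origin even for u = 0, so \<open>P\<close> has no
    zero on the compact set \<open>K\<close>. Its minimum there bounds \<open>P\<close> from below
    on these circles uniformly in u.\<close>
  define K :: "(complex \<times> complex) set" where "K = cball 0 r \<times> sphere 0 r"
  have "compact K" unfolding K_def by (intro compact_Times) auto
  moreover have "(0, of_real r) \<in> K" using r by (simp add: K_def)
  then have "K \<noteq> {}" by blast
  moreover have "continuous_on K (\<lambda>q. norm (eval2 P q))" by (intro continuous_intros)
  ultimately obtain k where k: "k \<in> K" "\<And>q. q \<in> K \<Longrightarrow> norm (eval2 P k) \<le> norm (eval2 P q)"
    by (metis continuous_attains_inf)
  define c where "c = norm (eval2 P k)"
  have "eval2 P k \<noteq> 0" using nz[of k] k(1) box[of "fst k" "snd k"] r by (auto simp: K_def)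
  then have c: "c > 0" by (simp add: c_def)
  have low: "norm (eval2 P (u, 0)) \<ge> c" if u: "u \<noteq> 0" "norm u \<le> r" for u
  proof -
    have Pn: "eval2 P (u, w) \<noteq> 0" if "w \<in> cball 0 r" for w
      using nz[of "(u, w)"] box[of u w] u that by auto
    have "norm (inverse (eval2 P (u, 0))) \<le> inverse c"
    proof (rule maximum_modulus_frontier[of "\<lambda>w. inverse (eval2 P (u, w))" "cball 0 r" "inverse c" 0])
      show "(\<lambda>w. inverse (eval2 P (u, w))) holomorphic_on interior (cball 0 r)"
        using Pn by (intro holomorphic_intros eval2_holomorphic) auto
      show "continuous_on (closure (cball 0 r)) (\<lambda>w. inverse (eval2 P (u, w)))"
        using Pn by (intro continuous_intros) auto
      fix w :: complex
      assume "w \<in> frontier (cball 0 r)"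
      then have "(u, w) \<in> K" using r u by (simp add: K_def)
      then show "norm (inverse (eval2 P (u, w))) \<le> inverse c"
        using k(2)[of "(u, w)"] c unfolding norm_inverse c_def by (intro le_imp_inverse_le) auto
    qed (use r in auto)
    moreover have "eval2 P (u, 0) \<noteq> 0" using Pn[of 0] r by simp
    ultimately show ?thesis using c by (simp add: norm_inverse)
  qed
  have "((\<lambda>u. norm (eval2 P (u, 0))) \<longlongrightarrow> norm (eval2 P (0, 0))) (at 0)"
    by (intro tendsto_intros)
  moreover have "\<forall>\<^sub>F u in at 0. c \<le> norm (eval2 P (u, 0))"
    unfolding eventually_at using r low by (intro exI[of _ r]) auto
  ultimately have "c \<le> norm (eval2 P (0, 0))" by (intro tendsto_lowerbound) auto
  with P0 c show False by simp
qed

text \<open>The equation is required on all of \<open>W\<close>, with no neighbourhood of \<open>p\<close>: multiplying \<open>P\<close> and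
  \<open>Q\<close> by a polynomial that vanishes outside a neighbourhood makes it trivial there.\<close>

definition locally_rational ::
    "(complex \<times> complex) set \<Rightarrow> complex \<times> complex \<Rightarrow> (complex \<times> complex \<Rightarrow> complex) \<Rightarrow> bool" where
  "locally_rational W p b \<longleftrightarrow>
     (\<exists>P Q. eval2 Q p \<noteq> 0 \<and> (\<forall>q\<in>W. b q * eval2 Q q = eval2 P q))"

text \<open>Bring one local fraction to lowest terms P/Q. Any other local fraction S/R satisfies P R
  = S Q as polynomials, so coprimality gives Q dvd R, and Q is nonzero wherever some R is, that is
  on all of \<open>W\<close>. A zero of Q at the origin would bring further zeros in
  \<open>W\<close>.\<close>

lemma hartogs_rational:
  assumes F0: "eval2 F (0, 0) \<noteq> 0"
    and FW: "\<And>q. q \<noteq> (0, 0) \<Longrightarrow> eval2 F q \<noteq> 0 \<Longrightarrow> q \<in> W"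
    and b: "\<And>p. p \<in> W \<Longrightarrow> locally_rational W p b"
  obtains P Q where "\<And>p. p \<in> insert (0, 0) W \<Longrightarrow> eval2 Q p \<noteq> 0"
    "\<And>q. q \<in> W \<Longrightarrow> b q * eval2 Q q = eval2 P q"
proof -
  \<comment> \<open>Non-isolation of zeros, applied to the zero polynomial, produces a point of
    \<open>W\<close>.\<close>
  have "eval2 0 (0, 0) = 0" by simp
  then obtain p0 where p0: "p0 \<noteq> (0, 0)" "eval2 F p0 \<noteq> 0"
    using F0 eval2_zero_not_isolated by blast
  then have p0W: "p0 \<in> W" using FW by blast
  obtain P0 Q0 where Q0: "eval2 Q0 p0 \<noteq> 0" "\<And>q. q \<in> W \<Longrightarrow> b q * eval2 Q0 q = eval2 P0 q"
    using b[OF p0W] unfolding locally_rational_def by blast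
  define d where "d = gcd P0 Q0"
  have "d \<noteq> 0" using Q0(1) by (auto simp: d_def)
  obtain P Q where PQ: "P0 = P * d" "Q0 = Q * d" "coprime P Q"
    using gcd_coprime_exists[of P0 Q0] \<open>d \<noteq> 0\<close> unfolding d_def by blast
  \<comment> \<open>A linear form that does not vanish at \<open>p0\<close>: \<open>F * L\<close> vanishes outside \<open>W\<close>.\<close>
  define L :: "complex poly poly" where "L = (if fst p0 = 0 then [:[:0, 1:]:] else [:0, 1:])"
  have L: "eval2 L p0 \<noteq> 0" "eval2 L (0, 0) = 0" using p0(1) by (auto simp: L_def prod_eq_iff)
  have cross: "P * R = S * Q"
    if RS: "\<And>q. q \<in> W \<Longrightarrow> b q * eval2 R q = eval2 S q" for R S
  proof -
    \<comment> \<open>The factor \<open>F * L\<close> makes the identity trivial outside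
      \<open>W\<close>; the factor \<open>d\<close> turns \<open>P\<close> and \<open>Q\<close> back
      into \<open>P0\<close> and \<open>Q0\<close>, for which the equation with \<open>b\<close> is
      known. All three factors are nonzero polynomials and cancel.\<close>
    have "(P * R) * (d * F * L) = (S * Q) * (d * F * L)"
    proof (rule eval2_eq_imp)
      fix q
      show "eval2 (P * R * (d * F * L)) q = eval2 (S * Q * (d * F * L)) q"
      proof (cases "eval2 F q = 0 \<or> eval2 L q = 0")
        case False
        then have "q \<noteq> (0, 0)" "eval2 F q \<noteq> 0" using L(2) by auto
        then have "q \<in> W" using FW by blast
        have Q0': "b q * eval2 (Q * d) q = eval2 (P * d) q"
          using Q0(2)[OF \<open>q \<in> W\<close>] unfolding PQ .
        have "eval2 (P * R * (d * F * L)) q = eval2 (P * d) q * eval2 R q * eval2 (F * L) q"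
          by simp
        also have "\<dots> = b q * eval2 (Q * d) q * eval2 R q * eval2 (F * L) q"
          unfolding Q0' ..
        also have "\<dots> = eval2 (S * Q * (d * F * L)) q"
          unfolding eval2_simps RS[OF \<open>q \<in> W\<close>, symmetric] by simp
        finally show ?thesis .
      qed auto
    qed
    moreover have "d \<noteq> 0" "F \<noteq> 0" "L \<noteq> 0" using Q0(1) PQ p0(2) L(1) by auto
    ultimately show ?thesis by simp
  qed
  have dvd: "Q dvd R" "b p * eval2 Q p = eval2 P p"
    if "\<And>q. q \<in> W \<Longrightarrow> b q * eval2 R q = eval2 S q" "p \<in> W" "eval2 R p \<noteq> 0" for R S p
  proof -
    have eq: "P * R = S * Q" using cross that(1) by blast
    then have "Q dvd P * R" by simp
    then show "Q dvd R" using PQ(3) by (simp add: coprime_commute coprime_dvd_mult_right_iff)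
    have "b p * eval2 Q p * eval2 R p = eval2 (S * Q) p" using that(1,2) by (simp add: algebra_simps)
    also have "\<dots> = eval2 P p * eval2 R p" unfolding eq[symmetric] by simp
    finally show "b p * eval2 Q p = eval2 P p" using that(3) by simp
  qed
  have QW: "eval2 Q p \<noteq> 0 \<and> b p * eval2 Q p = eval2 P p" if p: "p \<in> W" for p
  proof -
    obtain R S where RS: "eval2 R p \<noteq> 0" "\<And>q. q \<in> W \<Longrightarrow> b q * eval2 R q = eval2 S q"
      using b[OF p] unfolding locally_rational_def by blast
    with dvd[of R S p] p have "Q dvd R" "b p * eval2 Q p = eval2 P p" by blast+
    then show ?thesis using RS(1) by (auto elim!: dvdE)
  qed
  moreover have "eval2 Q (0, 0) \<noteq> 0"
  proof
    assume "eval2 Q (0, 0) = 0"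
    then obtain q where "q \<noteq> (0, 0)" "eval2 F q \<noteq> 0" "eval2 Q q = 0"
      using F0 eval2_zero_not_isolated by blast
    then show False using QW FW by blast
  qed
  ultimately show thesis by (intro that[of Q P]) auto
qed

section \<open>Parity and descent to polynomials in the square of the first variable\<close>

lemma eval2_square_decomp:
  "\<exists>A B. \<forall>u t. eval2 R (u, t) = eval2 A (u\<^sup>2, t) + u * eval2 B (u\<^sup>2, t)"
proof (induction R)
  case 0
  show ?case by (intro exI[of _ 0]) simp
next
  case (pCons a R)
  then obtain A B where "\<forall>u t. eval2 R (u, t) = eval2 A (u\<^sup>2, t) + u * eval2 B (u\<^sup>2, t)" by blast
  then show ?case
    by (intro exI[of _ "pCons a B"] exI[of _ A])
      (simp add: eval2_pCons algebra_simps power2_eq_square)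
qed

text \<open>Only the part of \<open>R\<close> with the parity of \<open>m\<close> survives. For odd
  \<open>m\<close> this is the odd part, and its factor \<open>u\<close> is the extra zero that
  later compensates the rounding in \<open>m div 2\<close>.\<close>

lemma eval2_parity_factor:
  assumes "\<And>u t. eval2 R (- u, t) = (-1) ^ m * eval2 R (u, t)"
  shows "\<exists>S. \<forall>u t. eval2 R (u, t) = u ^ (m mod 2) * eval2 S (u\<^sup>2, t)"
proof -
  obtain A B where AB: "\<forall>u t. eval2 R (u, t) = eval2 A (u\<^sup>2, t) + u * eval2 B (u\<^sup>2, t)"
    using eval2_square_decomp by blast
  show ?thesis
  proof (cases "even m")
    case True
    then have "eval2 R (u, t) = eval2 A (u\<^sup>2, t)" for u t
      using assms[of u t] AB[rule_format, of u t] AB[rule_format, of "- u" t] by simp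
    with True show ?thesis by (intro exI[of _ A]) simp
  next
    case False
    then have "eval2 R (u, t) = u * eval2 B (u\<^sup>2, t)" for u t
      using assms[of u t] AB[rule_format, of u t] AB[rule_format, of "- u" t]
      by (simp add: add_eq_0_iff)
    moreover have "m mod 2 = 1" using False by presburger
    ultimately show ?thesis by (intro exI[of _ B]) simp
  qed
qed

text \<open>Parity of \<open>b\<close> on \<open>W\<close> does not by itself make numerator and
  denominator even or odd. Expanding the fraction by Q(-q) gives the even denominator Q(q) Q(-q),
  and the numerator is then averaged with its image under the sign change.\<close>

lemma hartogs_rational_parity:
  assumes "eval2 F (0, 0) \<noteq> 0"
    and "\<And>q. q \<noteq> (0, 0) \<Longrightarrow> eval2 F q \<noteq> 0 \<Longrightarrow> q \<in> W"
    and "\<And>p. p \<in> W \<Longrightarrow> locally_rational W p b"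
    and W: "\<And>q. q \<in> W \<Longrightarrow> - q \<in> W"
    and b: "\<And>q. q \<in> W \<Longrightarrow> b (- q) = (-1) ^ m * b q"
  obtains P Q where "\<And>p. p \<in> insert (0, 0) W \<Longrightarrow> eval2 Q p \<noteq> 0"
    "\<And>q. q \<in> W \<Longrightarrow> b q * eval2 Q q = eval2 P q"
    "\<And>q. eval2 Q (- q) = eval2 Q q"
    "\<And>q. eval2 P (- q) = (-1) ^ m * eval2 P q"
proof -
  obtain P Q where Q: "\<And>p. p \<in> insert (0, 0) W \<Longrightarrow> eval2 Q p \<noteq> 0"
    and PQ: "\<And>q. q \<in> W \<Longrightarrow> b q * eval2 Q q = eval2 P q"
    using hartogs_rational[of F W b] assms(1-3) by metis
  have "\<exists>R. \<forall>q. eval2 R q = eval2 S (- q)" for S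
    using eval2_compose[of S "[:[:-1:]:] * [:0, 1:]" "[:[:-1:]:] * [:[:0, 1:]:]"]
    by (simp only: eval2_simps) (simp add: uminus_prod_def)
  then obtain P' Q' where P': "\<And>q. eval2 P' q = eval2 P (- q)"
    and Q': "\<And>q. eval2 Q' q = eval2 Q (- q)" by metis
  \<comment> \<open>On \<open>W\<close> both summands equal b(q) Q(q) Q(-q), so the average keeps
    this value, while at every point of the plane it has the parity of \<open>m\<close>.\<close>
  define R where "R = [:[:1/2:]:] * (P * Q' + [:[:(-1) ^ m:]:] * (P' * Q))"
  have R: "eval2 R q = (eval2 P q * eval2 Q (- q) + (-1) ^ m * (eval2 P (- q) * eval2 Q q)) / 2" for q
    unfolding R_def by (simp only: eval2_simps P' Q') simp
  have sq: "(-1) ^ m * ((-1) ^ m * z) = z" for z :: complex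
    by (simp add: mult.assoc[symmetric] power_add[symmetric])
  show thesis
  proof (rule that[of "Q * Q'" R])
    fix p assume "p \<in> insert (0, 0) W"
    moreover from this have "- p \<in> insert (0, 0) W" using W by (auto simp: uminus_prod_def)
    ultimately show "eval2 (Q * Q') p \<noteq> 0" using Q by (simp add: Q')
  next
    fix q assume q: "q \<in> W"
    have "eval2 P (- q) = (-1) ^ m * b q * eval2 Q (- q)"
      using PQ[OF W[OF q]] b[OF q] by simp
    then have "(-1) ^ m * eval2 P (- q) = b q * eval2 Q (- q)"
      using sq[of "b q * eval2 Q (- q)"] by (simp add: mult.assoc)
    then show "b q * eval2 (Q * Q') q = eval2 R q"
      unfolding R mult.assoc[symmetric] using PQ[OF q] by (simp add: Q' field_simps)
  next
    fix q
    show "eval2 (Q * Q') (- q) = eval2 (Q * Q') q" by (simp add: Q' mult.commute)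
    show "eval2 R (- q) = (-1) ^ m * eval2 R q"
      unfolding R using sq[of "eval2 P (- q) * eval2 Q q"] by (simp add: algebra_simps)
  qed
qed

section \<open>Polynomial functions and tangent spaces\<close>

lemma poly_fun_eval2_compose:
  assumes "poly_fun f"
  shows "\<exists>P. \<forall>q. eval2 P q = f (\<chi> i. eval2 (A i) q)"
  using assms
proof induction
  case (const c)
  show ?case by (intro exI[of _ "[:[:c:]:]"]) simp
next
  case (coord i)
  show ?case by (intro exI[of _ "A i"]) simp
next
  case (add f g)
  then obtain P Q where "\<forall>q. eval2 P q = f (\<chi> i. eval2 (A i) q)"
    "\<forall>q. eval2 Q q = g (\<chi> i. eval2 (A i) q)" by blast
  then show ?case by (intro exI[of _ "P + Q"]) simp
next
  case (mult f g)
  then obtain P Q where "\<forall>q. eval2 P q = f (\<chi> i. eval2 (A i) q)"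
    "\<forall>q. eval2 Q q = g (\<chi> i. eval2 (A i) q)" by blast
  then show ?case by (intro exI[of _ "P * Q"]) simp
qed

lemma poly_fun_poly:
  assumes "poly_fun f"
  shows "poly_fun (\<lambda>p. poly a (f p))"
proof (induction a)
  case 0
  show ?case by (simp add: poly_fun.const)
next
  case (pCons c a)
  then show ?case unfolding poly_pCons by (intro poly_fun.add poly_fun.mult poly_fun.const assms)
qed

lemma poly_fun_eval2:
  assumes "poly_fun f" "poly_fun g"
  shows "poly_fun (\<lambda>p. eval2 P (f p, g p))"
proof (induction P)
  case 0
  show ?case by (simp add: poly_fun.const)
next
  case (pCons a P)
  then show ?case unfolding eval2_pCons fst_conv snd_conv
    by (intro poly_fun.add poly_fun.mult poly_fun_poly assms)
qed

lemma poly_fun_differentiable: "poly_fun f \<Longrightarrow> f differentiable (at p)"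
  by (induction rule: poly_fun.induct)
    (auto intro!: bounded_linear_imp_differentiable bounded_linear_vec_nth)

lemma poly_fun_continuous: "poly_fun f \<Longrightarrow> continuous_on S f"
  by (induction rule: poly_fun.induct) (auto intro!: continuous_intros)

lemma zariski_open_imp_open:
  assumes "zariski_open U"
  shows "open U"
proof -
  from assms obtain F where F: "\<And>f. f \<in> F \<Longrightarrow> poly_fun f" and U: "U = {x. \<exists>f\<in>F. f x \<noteq> 0}"
    unfolding zariski_open_def by blast
  have "open (\<Union>f\<in>F. {x. f x \<noteq> 0})"
    using F by (intro open_UN ballI open_Collect_neq poly_fun_continuous continuous_on_const)
  also have "(\<Union>f\<in>F. {x. f x \<noteq> 0}) = U" using U by blast
  finally show ?thesis .
qed

text \<open>Provides a single polynomial that can serve as a multiplier killing everything outside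
  \<open>U\<close>.\<close>

lemma zariski_open_basic:
  assumes "zariski_open U" "p \<in> U"
  obtains f where "poly_fun f" "f p \<noteq> 0" "\<And>x. f x \<noteq> 0 \<Longrightarrow> x \<in> U"
  using assms unfolding zariski_open_def by blast

lemma zariski_open_UNIV: "zariski_open UNIV"
  unfolding zariski_open_def by (intro exI[of _ "{\<lambda>_. 1}"]) (auto intro: poly_fun.const)

text \<open>A polynomial vanishing on \<open>V\<close> vanishes along the curve, so by the chain
  rule its differential kills the velocity. A real parameter is enough because
  \<open>frechet_derivative\<close> is a real derivative.\<close>

lemma tangent_space_curve:
  fixes V :: "(complex ^ 'n::finite) set"
  assumes g: "(g has_vector_derivative v) (at 0)" and V: "\<forall>\<^sub>F e in at 0. g e \<in> V" "g 0 \<in> V"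
  shows "v \<in> tangent_space V (g 0)"
  unfolding tangent_space_def
proof (intro CollectI allI impI, elim conjE)
  fix f :: "complex ^ 'n \<Rightarrow> complex"
  assume f: "poly_fun f" and f0: "\<forall>x\<in>V. f x = 0"
  have "(f has_derivative frechet_derivative f (at (g 0))) (at (g 0))"
    using poly_fun_differentiable[OF f] frechet_derivative_works by blast
  then have "((f \<circ> g) has_derivative frechet_derivative f (at (g 0)) \<circ> (\<lambda>x. x *\<^sub>R v)) (at 0)"
    using g unfolding has_vector_derivative_def by (intro diff_chain_at)
  moreover have "\<forall>\<^sub>F e in at 0. (f \<circ> g) e = (\<lambda>_. 0) e"
    using V(1) by eventually_elim (use f0 in simp)
  ultimately have "((\<lambda>_. 0) has_derivative frechet_derivative f (at (g 0)) \<circ> (\<lambda>x. x *\<^sub>R v)) (at 0)"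
    by (rule has_derivative_transform_eventually) (use f0 V in auto)
  then have "frechet_derivative f (at (g 0)) \<circ> (\<lambda>x. x *\<^sub>R v) = (\<lambda>_. 0)"
    by (rule has_derivative_unique) simp
  then show "frechet_derivative f (at (g 0)) v = 0"
    by (auto dest: fun_cong[of _ _ 1])
qed

lemma tangent_space_mono: "S \<subseteq> T \<Longrightarrow> tangent_space S p \<subseteq> tangent_space T p"
  unfolding tangent_space_def by auto

section \<open>Binary forms with coefficients in an algebra of functions\<close>

definition function_subalgebra :: "('q \<Rightarrow> complex) set \<Rightarrow> bool" where
  "function_subalgebra R \<longleftrightarrow> (\<forall>c. (\<lambda>_. c) \<in> R) \<and>
     (\<forall>f\<in>R. \<forall>g\<in>R. (\<lambda>q. f q + g q) \<in> R \<and> (\<lambda>q. f q * g q) \<in> R)"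

text \<open>The coefficient algebra is a parameter because two are used: functions that are locally
  rational at a point of the plane, and global quotients on a chart of the blow-up.\<close>

definition binary_form ::
    "('q \<Rightarrow> complex) set \<Rightarrow> 'q set \<Rightarrow> nat \<Rightarrow> ('q \<Rightarrow> complex \<Rightarrow> complex \<Rightarrow> complex) \<Rightarrow> bool" where
  "binary_form R S n f \<longleftrightarrow>
     (\<exists>c. (\<forall>j. c j \<in> R) \<and> (\<forall>q\<in>S. \<forall>x y. f q x y = (\<Sum>j\<le>n. c j q * x ^ j * y ^ (n - j))))"

lemma binary_form_const:
  assumes "c \<in> R"
  shows "binary_form R S 0 (\<lambda>q x y. c q)"
  unfolding binary_form_def using assms by (intro exI[of _ "\<lambda>_. c"]) auto

lemma binary_form_zero:
  assumes "function_subalgebra R"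
  shows "binary_form R S n (\<lambda>q x y. 0)"
  unfolding binary_form_def using assms
  by (intro exI[of _ "\<lambda>_ _. 0"]) (auto simp: function_subalgebra_def)

lemma binary_form_add:
  assumes R: "function_subalgebra R" and "binary_form R S n f" "binary_form R S n g"
  shows "binary_form R S n (\<lambda>q x y. f q x y + g q x y)"
proof -
  obtain c d where "\<forall>j. c j \<in> R" "\<forall>j. d j \<in> R"
    "\<forall>q\<in>S. \<forall>x y. f q x y = (\<Sum>j\<le>n. c j q * x ^ j * y ^ (n - j))"
    "\<forall>q\<in>S. \<forall>x y. g q x y = (\<Sum>j\<le>n. d j q * x ^ j * y ^ (n - j))"
    using assms(2,3) unfolding binary_form_def by blast
  then show ?thesis unfolding binary_form_def
    using R by (intro exI[of _ "\<lambda>j q. c j q + d j q"])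
      (auto simp: function_subalgebra_def sum.distrib distrib_right)
qed

lemma binary_form_sum:
  assumes "function_subalgebra R" "\<And>i. i \<in> I \<Longrightarrow> binary_form R S n (f i)"
  shows "binary_form R S n (\<lambda>q x y. \<Sum>i\<in>I. f i q x y)"
  using assms(2) by (induction I rule: infinite_finite_induct)
    (auto intro: binary_form_zero binary_form_add assms(1))

lemma binary_form_mult_linear:
  assumes R: "function_subalgebra R" and f: "binary_form R S n f" and ab: "a \<in> R" "b \<in> R"
  shows "binary_form R S (Suc n) (\<lambda>q x y. (a q * x + b q * y) * f q x y)"
proof -
  obtain c where c: "\<forall>j. c j \<in> R"
    "\<And>q x y. q \<in> S \<Longrightarrow> f q x y = (\<Sum>j\<le>n. c j q * x ^ j * y ^ (n - j))"
    using f unfolding binary_form_def by blast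
  \<comment> \<open>Coefficients of the product by comparison of powers. Both tests matter:
    \<open>j - 1\<close> is truncated at \<open>j = 0\<close>, and nothing is known about
    \<open>c j\<close> for \<open>j > n\<close>.\<close>
  define d where "d j q = (if j = 0 then 0 else a q * c (j - 1) q) + (if j \<le> n then b q * c j q else 0)"
    for j q
  have "d j \<in> R" for j
    using R c(1) ab unfolding d_def function_subalgebra_def by (cases "j = 0"; cases "j \<le> n") auto
  moreover have "(a q * x + b q * y) * f q x y = (\<Sum>j\<le>Suc n. d j q * x ^ j * y ^ (Suc n - j))"
    if q: "q \<in> S" for q x y
  proof -
    have 1: "a q * x * f q x y
      = (\<Sum>j\<le>Suc n. (if j = 0 then 0 else a q * c (j - 1) q) * x ^ j * y ^ (Suc n - j))"
      unfolding sum.atMost_Suc_shift by (simp add: c(2)[OF q] sum_distrib_left algebra_simps)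
    have "b q * y * f q x y = (\<Sum>j\<le>n. b q * c j q * x ^ j * y ^ (Suc n - j))"
      unfolding c(2)[OF q] sum_distrib_left
      by (intro sum.cong refl) (simp add: Suc_diff_le algebra_simps)
    also have "\<dots> = (\<Sum>j\<le>Suc n. (if j \<le> n then b q * c j q else 0) * x ^ j * y ^ (Suc n - j))"
      by simp
    finally show ?thesis
      using 1 unfolding d_def by (simp only: distrib_right sum.distrib)
  qed
  ultimately show ?thesis unfolding binary_form_def by blast
qed

lemma binary_form_mult_linear_power:
  assumes "function_subalgebra R" "binary_form R S n f" "a \<in> R" "b \<in> R"
  shows "binary_form R S (k + n) (\<lambda>q x y. (a q * x + b q * y) ^ k * f q x y)"
proof (induction k)
  case 0
  then show ?case using assms(2) by simp
next
  case (Suc k)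
  from binary_form_mult_linear[OF assms(1) Suc assms(3,4)] show ?case by (simp add: mult.assoc)
qed

lemma binary_form_unique:
  fixes c d :: "nat \<Rightarrow> complex"
  assumes "\<And>x y. (\<Sum>j\<le>n. c j * x ^ j * y ^ (n - j)) = (\<Sum>j\<le>n. d j * x ^ j * y ^ (n - j))" and "j \<le> n"
  shows "c j = d j"
proof -
  have "\<forall>x. (\<Sum>j\<le>n. c j * x ^ j) = (\<Sum>j\<le>n. d j * x ^ j)"
    using assms(1)[of _ 1] by simp
  then show ?thesis using assms(2) polyfun_eq_coeffs by blast
qed

lemma function_subalgebra_locally_rational:
  "function_subalgebra {b. locally_rational W p b}"
  unfolding function_subalgebra_def
proof (intro conjI allI ballI)
  fix c :: complex
  show "(\<lambda>_. c) \<in> {b. locally_rational W p b}"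
    unfolding mem_Collect_eq locally_rational_def
    by (intro exI[of _ "[:[:c:]:]"] exI[of _ 1]) simp
next
  fix f g assume "f \<in> {b. locally_rational W p b}" "g \<in> {b. locally_rational W p b}"
  then obtain P Q P' Q' where nz: "eval2 Q p \<noteq> 0" "eval2 Q' p \<noteq> 0"
    and "\<forall>q\<in>W. f q * eval2 Q q = eval2 P q" "\<forall>q\<in>W. g q * eval2 Q' q = eval2 P' q"
    unfolding locally_rational_def by blast
  then have eq: "\<And>q. q \<in> W \<Longrightarrow> eval2 P q = f q * eval2 Q q"
    "\<And>q. q \<in> W \<Longrightarrow> eval2 P' q = g q * eval2 Q' q" by simp_all
  show "(\<lambda>q. f q + g q) \<in> {b. locally_rational W p b}"
    unfolding mem_Collect_eq locally_rational_def
    by (intro exI[of _ "P * Q' + P' * Q"] exI[of _ "Q * Q'"])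
      (use nz eq in \<open>simp add: algebra_simps\<close>)
  show "(\<lambda>q. f q * g q) \<in> {b. locally_rational W p b}"
    unfolding mem_Collect_eq locally_rational_def
    by (intro exI[of _ "P * P'"] exI[of _ "Q * Q'"]) (use nz eq in simp)
qed

section \<open>The double cover of the cone by the plane\<close>

definition cone_param :: "complex \<times> complex \<Rightarrow> complex ^ 3" where
  "cone_param q = vector [(fst q)\<^sup>2, fst q * snd q, (snd q)\<^sup>2]"

definition cone_param_deriv :: "complex \<times> complex \<Rightarrow> complex \<times> complex \<Rightarrow> complex ^ 3" where
  "cone_param_deriv q r = vector [2 * fst q * fst r, fst q * snd r + snd q * fst r, 2 * snd q * snd r]"

lemma cone_param_nth [simp]:
  "cone_param q $ 1 = (fst q)\<^sup>2" "cone_param q $ 2 = fst q * snd q" "cone_param q $ 3 = (snd q)\<^sup>2"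
  by (simp_all add: cone_param_def)

lemma cone_param_deriv_nth [simp]:
  "cone_param_deriv q r $ 1 = 2 * fst q * fst r"
  "cone_param_deriv q r $ 2 = fst q * snd r + snd q * fst r"
  "cone_param_deriv q r $ 3 = 2 * snd q * snd r"
  by (simp_all add: cone_param_deriv_def)

lemma cone_param_uminus [simp]: "cone_param (- q) = cone_param q"
  by (simp add: vec_eq_iff forall_3)

lemma cone_param_deriv_uminus [simp]: "cone_param_deriv (- q) (- r) = cone_param_deriv q r"
  by (simp add: vec_eq_iff forall_3)

lemma cone_param_in_cone [simp]: "cone_param q \<in> quadric_cone"
  by (simp add: quadric_cone_def power_mult_distrib)

lemma cone_param_eq_0_iff [simp]: "cone_param q = 0 \<longleftrightarrow> q = (0, 0)"
  by (auto simp: vec_eq_iff forall_3 prod_eq_iff)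

lemma cone_param_has_vector_derivative:
  "((\<lambda>e::real. cone_param (fst q + of_real e * fst r, snd q + of_real e * snd r))
     has_vector_derivative cone_param_deriv q r) (at 0)"
proof -
  \<comment> \<open>The parametrisation is homogeneous quadratic, so its expansion along a line is
    exact, and the term in e^2 does not contribute at 0.\<close>
  have "cone_param (fst q + of_real e * fst r, snd q + of_real e * snd r) =
      cone_param q + e *\<^sub>R cone_param_deriv q r + e\<^sup>2 *\<^sub>R cone_param r" for e :: real
    by (simp add: vec_eq_iff forall_3 scaleR_conv_of_real[where 'a = complex] algebra_simps power2_eq_square)
  then show ?thesis by (auto intro!: derivative_eq_intros)
qed

lemma cone_param_0 [simp]: "cone_param (0, 0) = 0"
  by simp

lemma poly_fun_cone_param:
  assumes "poly_fun f"
  shows "\<exists>P. \<forall>q. eval2 P q = f (cone_param q)"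
proof -
  define A :: "3 \<Rightarrow> complex poly poly" where
    "A i = (if i = 1 then [:0, 1:] ^ 2 else if i = 2 then [:0, 1:] * [:[:0, 1:]:] else [:[:0, 1:]:] ^ 2)" for i
  have "(\<chi> i. eval2 (A i) q) = cone_param q" for q
    by (simp add: vec_eq_iff forall_3 A_def eval2_pCons)
  then show ?thesis using poly_fun_eval2_compose[OF assms, of A] by simp
qed

section \<open>Pulling differentials back from the punctured neighbourhood to the plane\<close>

locale A1_neighbourhood =
  fixes X :: "(complex ^ 3) set"
  assumes A1: "A1_singularity X"
begin

definition W :: "(complex \<times> complex) set" where
  "W = {q. cone_param q \<in> X - {0}}"

lemma zero_in_X: "0 \<in> X"
  using A1 by (auto simp: A1_singularity_def quadric_cone_def)

lemma X_subset_cone: "x \<in> X \<Longrightarrow> x \<in> quadric_cone"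
  using A1 by (auto simp: A1_singularity_def)

text \<open>Zariski open sets are open in the usual topology. This keeps curves and limits that run
  inside the cone within \<open>X\<close>.\<close>

lemma X_relatively_open:
  assumes "(f \<longlongrightarrow> x) F" "x \<in> X" "\<And>e. f e \<in> quadric_cone"
  shows "\<forall>\<^sub>F e in F. f e \<in> X"
proof -
  obtain U where U: "zariski_open U" "X = quadric_cone \<inter> U"
    using A1 by (auto simp: A1_singularity_def)
  have "\<forall>\<^sub>F e in F. f e \<in> U"
    using assms U zariski_open_imp_open by (auto intro: topological_tendstoD)
  then show ?thesis by eventually_elim (use U assms in auto)
qed

text \<open>Pulls back a polynomial that is nonzero at the vertex. This is the punctured Zariski
  neighbourhood of the origin that Hartogs extension requires.\<close>

lemma W_contains_basic:
  obtains F where "eval2 F (0, 0) \<noteq> 0" "\<And>q. q \<noteq> (0, 0) \<Longrightarrow> eval2 F q \<noteq> 0 \<Longrightarrow> q \<in> W"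
proof -
  obtain U where U: "zariski_open U" "0 \<in> U" "X = quadric_cone \<inter> U"
    using A1 by (auto simp: A1_singularity_def)
  obtain f where f: "poly_fun f" "f 0 \<noteq> 0" "\<And>x. f x \<noteq> 0 \<Longrightarrow> x \<in> U"
    using zariski_open_basic[OF U(1,2)] by metis
  obtain F where F: "\<And>q. eval2 F q = f (cone_param q)" using poly_fun_cone_param[OF f(1)] by blast
  show thesis
  proof (rule that[of F])
    show "eval2 F (0, 0) \<noteq> 0" using f(2) by (simp add: F)
    fix q assume "q \<noteq> (0, 0)" "eval2 F q \<noteq> 0"
    moreover from this have "cone_param q \<in> X" unfolding U(3) using f(3)[of "cone_param q"] by (simp add: F)
    ultimately show "q \<in> W" by (simp add: W_def)
  qed
qed

lemma W_uminus: "q \<in> W \<Longrightarrow> - q \<in> W"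
  unfolding W_def mem_Collect_eq cone_param_uminus .

lemma cone_param_deriv_tangent:
  assumes q: "q \<in> W"
  shows "cone_param_deriv q r \<in> tangent_space (X - {0}) (cone_param q)"
proof -
  define g where "g = (\<lambda>e::real. cone_param (fst q + of_real e * fst r, snd q + of_real e * snd r))"
  have g: "(g has_vector_derivative cone_param_deriv q r) (at 0)"
    unfolding g_def by (rule cone_param_has_vector_derivative)
  then have lim: "(g \<longlongrightarrow> g 0) (at 0)"
    using has_vector_derivative_continuous continuous_within by blast
  have g0: "g 0 = cone_param q" by (simp add: g_def)
  have "\<forall>\<^sub>F e in at 0. g e \<in> X"
    using q lim by (intro X_relatively_open[of g "g 0"]) (auto simp: W_def g0, auto simp: g_def)
  moreover have "\<forall>\<^sub>F e in at 0. g e \<in> - {0}"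
    using q lim by (intro topological_tendstoD[OF lim]) (auto simp: W_def g0)
  ultimately have "\<forall>\<^sub>F e in at 0. g e \<in> X - {0}"
    by eventually_elim auto
  from tangent_space_curve[OF g this] q show ?thesis
    by (simp add: g0 W_def)
qed

text \<open>Each coordinate differential pulls back to a linear form in (du, dv) with polynomial
  coefficients, so a monomial of degree \<open>m\<close> becomes a binary form of degree
  \<open>m\<close>. The factor \<open>F\<close>, pulled back from a polynomial supported in a
  neighbourhood of the point, makes the identity hold on all of \<open>W\<close>, as
  \<open>locally_rational\<close> demands.\<close>

lemma pullback_local_form:
  assumes eta: "regular_sym_diff m (X - {0}) \<eta>" and p: "p \<in> W"
  obtains F where "eval2 F p \<noteq> 0"
    "binary_form {b. locally_rational W p b} W m
       (\<lambda>q x y. eval2 F q * \<eta> (cone_param q) (cone_param_deriv q (x, y)))"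
proof -
  define R where "R = {b. locally_rational W p b}"
  have R: "function_subalgebra R" unfolding R_def by (rule function_subalgebra_locally_rational)
  have evR: "(\<lambda>q. eval2 P q) \<in> R" for P
    unfolding R_def mem_Collect_eq locally_rational_def by (intro exI[of _ P] exI[of _ 1]) simp
  from p have pX: "cone_param p \<in> X - {0}" by (simp add: W_def)
  obtain U a where U: "zariski_open U" "cone_param p \<in> U"
    and a: "\<And>\<alpha>. regular_on ((X - {0}) \<inter> U) (a \<alpha>)"
    and eq: "\<And>x v. x \<in> (X - {0}) \<inter> U \<Longrightarrow> v \<in> tangent_space (X - {0}) x \<Longrightarrow>
      \<eta> x v = (\<Sum>\<alpha> | (\<Sum>i\<in>UNIV. \<alpha> i) = m. a \<alpha> x * (\<Prod>i\<in>UNIV. (v $ i) ^ \<alpha> i))"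
    using eta[unfolded regular_sym_diff_def, rule_format, OF pX] by blast
  obtain f where f: "poly_fun f" "f (cone_param p) \<noteq> 0" "\<And>x. f x \<noteq> 0 \<Longrightarrow> x \<in> U"
    using zariski_open_basic[OF U] by metis
  obtain F where F: "\<And>q. eval2 F q = f (cone_param q)" using poly_fun_cone_param[OF f(1)] by blast
  \<comment> \<open>Nothing is known about \<open>a \<alpha>\<close> outside \<open>U\<close>; there
    \<open>F\<close> vanishes and removes it.\<close>
  define c where "c \<alpha> q = (if eval2 F q = 0 then 0 else eval2 F q * a \<alpha> (cone_param q))" for \<alpha> q
  have cR: "c \<alpha> \<in> R" for \<alpha>
  proof -
    obtain U' g h where U': "zariski_open U'" "cone_param p \<in> U'" and gh: "poly_fun g" "poly_fun h"
      and ah: "\<And>x. x \<in> (X - {0}) \<inter> U \<inter> U' \<Longrightarrow> h x \<noteq> 0 \<and> a \<alpha> x = g x / h x"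
      using a[of \<alpha>, unfolded regular_on_def, rule_format, of "cone_param p"] pX U by blast
    obtain f' where f': "poly_fun f'" "f' (cone_param p) \<noteq> 0" "\<And>x. f' x \<noteq> 0 \<Longrightarrow> x \<in> U'"
      using zariski_open_basic[OF U'] by metis
    obtain F' where F': "\<And>q. eval2 F' q = f' (cone_param q)"
      using poly_fun_cone_param[OF f'(1)] by blast
    obtain G where G: "\<And>q. eval2 G q = g (cone_param q)" using poly_fun_cone_param[OF gh(1)] by blast
    obtain H where H: "\<And>q. eval2 H q = h (cone_param q)" using poly_fun_cone_param[OF gh(2)] by blast
    have "eval2 (H * F') p \<noteq> 0"
      using ah[of "cone_param p"] pX U(2) U'(2) f'(2) by (simp add: H F')
    \<comment> \<open>The fraction g/h is valid only on \<open>U'\<close>; the factor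
      \<open>F'\<close> on both sides makes the equation trivial elsewhere.\<close>
    moreover have "c \<alpha> q * eval2 (H * F') q = eval2 (F * G * F') q" if q: "q \<in> W" for q
    proof (cases "eval2 F q = 0 \<or> eval2 F' q = 0")
      case False
      then have "cone_param q \<in> (X - {0}) \<inter> U \<inter> U'"
        using q f(3) f'(3) F F' by (auto simp: W_def)
      from ah[OF this] show ?thesis using False by (simp add: c_def G H)
    qed (auto simp: c_def)
    ultimately show ?thesis unfolding R_def locally_rational_def by blast
  qed
  have "binary_form R W m (\<lambda>q x y. \<Sum>\<alpha> | (\<Sum>i\<in>UNIV. \<alpha> i) = m. 
      c \<alpha> q * (\<Prod>i\<in>UNIV. (cone_param_deriv q (x, y) $ i) ^ \<alpha> i))"
  proof (rule binary_form_sum[OF R])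
    fix \<alpha> :: "3 \<Rightarrow> nat"
    assume "\<alpha> \<in> {\<alpha>. (\<Sum>i\<in>UNIV. \<alpha> i) = m}"
    \<comment> \<open>The bracketing copies the nesting of the product below: powers of 2u x, v x +
      u y and 2v y, around a coefficient of degree 0.\<close>
    then have m: "\<alpha> 1 + (\<alpha> 2 + (\<alpha> 3 + 0)) = m" by (simp add: sum_3)
    have "binary_form R W m (\<lambda>q x y.
        (eval2 ([:[:2:]:] * [:0, 1:]) q * x + eval2 0 q * y) ^ \<alpha> 1 *
       ((eval2 [:[:0, 1:]:] q * x + eval2 [:0, 1:] q * y) ^ \<alpha> 2 *
       ((eval2 0 q * x + eval2 ([:[:2:]:] * [:[:0, 1:]:]) q * y) ^ \<alpha> 3 * c \<alpha> q)))"
      unfolding m[symmetric]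
      by (intro binary_form_mult_linear_power R evR binary_form_const cR)
    also have "(\<lambda>q x y.
        (eval2 ([:[:2:]:] * [:0, 1:]) q * x + eval2 0 q * y) ^ \<alpha> 1 *
       ((eval2 [:[:0, 1:]:] q * x + eval2 [:0, 1:] q * y) ^ \<alpha> 2 *
       ((eval2 0 q * x + eval2 ([:[:2:]:] * [:[:0, 1:]:]) q * y) ^ \<alpha> 3 * c \<alpha> q))) =
       (\<lambda>q x y. c \<alpha> q * (\<Prod>i\<in>UNIV. (cone_param_deriv q (x, y) $ i) ^ \<alpha> i))"
      unfolding eval2_simps UNIV_3 by (intro ext) (simp add: add.commute)
    finally show "binary_form R W m (\<lambda>q x y. c \<alpha> q * (\<Prod>i\<in>UNIV. (cone_param_deriv q (x, y) $ i) ^ \<alpha> i))" .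
  qed
  moreover have "eval2 F q * \<eta> (cone_param q) (cone_param_deriv q r) =
     (\<Sum>\<alpha> | (\<Sum>i\<in>UNIV. \<alpha> i) = m. c \<alpha> q * (\<Prod>i\<in>UNIV. (cone_param_deriv q r $ i) ^ \<alpha> i))"
    if q: "q \<in> W" for q r
  proof (cases "eval2 F q = 0")
    case False
    then have "cone_param q \<in> (X - {0}) \<inter> U" using q f(3) F by (auto simp: W_def)
    from eq[OF this cone_param_deriv_tangent[OF q, of r]] show ?thesis
      using False by (simp add: c_def sum_distrib_left mult.assoc)
  qed (simp add: c_def)
  ultimately have "binary_form R W m
       (\<lambda>q x y. eval2 F q * \<eta> (cone_param q) (cone_param_deriv q (x, y)))"
    unfolding binary_form_def by simp
  then show thesis using that[of F] f(2) F unfolding R_def by simp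
qed

text \<open>The local identities carry different multipliers \<open>F p\<close>, but coefficients of
  a binary form are unique, so the quotients of local coefficients by multipliers agree. Parity
  holds because changing the sign of both point and vector leaves their images on the cone
  unchanged, while a form of degree \<open>m\<close> in the vector picks up (-1)^m.\<close>

lemma pullback_form:
  assumes eta: "regular_sym_diff m (X - {0}) \<eta>"
  obtains b where "\<And>j p. p \<in> W \<Longrightarrow> locally_rational W p (b j)"
    "\<And>q x y. q \<in> W \<Longrightarrow>
       \<eta> (cone_param q) (cone_param_deriv q (x, y)) = (\<Sum>j\<le>m. b j q * x ^ j * y ^ (m - j))"
    "\<And>j q. q \<in> W \<Longrightarrow> b j (- q) = (-1) ^ m * b j q"
proof -
  have "\<exists>F c. eval2 F p \<noteq> 0 \<and> (\<forall>j. locally_rational W p (c j)) \<and> (\<forall>q\<in>W. \<forall>x y.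
      eval2 F q * \<eta> (cone_param q) (cone_param_deriv q (x, y)) = (\<Sum>j\<le>m. c j q * x ^ j * y ^ (m - j)))"
    if "p \<in> W" for p
    using pullback_local_form[OF eta that] unfolding binary_form_def mem_Collect_eq by metis
  then have "\<forall>p\<in>W. \<exists>Fc. eval2 (fst Fc) p \<noteq> 0 \<and> (\<forall>j. locally_rational W p (snd Fc j)) \<and> (\<forall>q\<in>W. \<forall>x y.
      eval2 (fst Fc) q * \<eta> (cone_param q) (cone_param_deriv q (x, y)) = (\<Sum>j\<le>m. snd Fc j q * x ^ j * y ^ (m - j)))"
    unfolding fst_conv snd_conv split_paired_Ex by blast
  from bchoice[OF this] obtain Fc where "\<forall>p\<in>W. eval2 (fst (Fc p)) p \<noteq> 0 \<and>
      (\<forall>j. locally_rational W p (snd (Fc p) j)) \<and> (\<forall>q\<in>W. \<forall>x y.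
      eval2 (fst (Fc p)) q * \<eta> (cone_param q) (cone_param_deriv q (x, y)) =
        (\<Sum>j\<le>m. snd (Fc p) j q * x ^ j * y ^ (m - j)))" ..
  moreover define F c where "F p = fst (Fc p)" and "c p = snd (Fc p)" for p
  ultimately have Fp: "\<And>p. p \<in> W \<Longrightarrow> eval2 (F p) p \<noteq> 0"
    and c: "\<And>p j. p \<in> W \<Longrightarrow> locally_rational W p (c p j)"
    and eq: "\<And>p q x y. p \<in> W \<Longrightarrow> q \<in> W \<Longrightarrow>
      eval2 (F p) q * \<eta> (cone_param q) (cone_param_deriv q (x, y)) = (\<Sum>j\<le>m. c p j q * x ^ j * y ^ (m - j))"
    unfolding F_def c_def by blast+
  \<comment> \<open>At each point its own local identity is used; the comparison with the identity
    chosen at a fixed \<open>p\<close> is made afterwards, by uniqueness.\<close>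
  define b where "b j q = (if j \<le> m then c q j q / eval2 (F q) q else 0)" for j q
  have form: "\<eta> (cone_param q) (cone_param_deriv q (x, y)) = (\<Sum>j\<le>m. b j q * x ^ j * y ^ (m - j))"
    if q: "q \<in> W" for q x y
  proof -
    have "\<eta> (cone_param q) (cone_param_deriv q (x, y)) = (\<Sum>j\<le>m. c q j q * x ^ j * y ^ (m - j)) / eval2 (F q) q"
      unfolding eq[OF q q, symmetric] using Fp[OF q] by simp
    then show ?thesis by (simp add: b_def sum_divide_distrib)
  qed
  have "locally_rational W p (b j)" if p: "p \<in> W" for j p
  proof (cases "j \<le> m")
    case True
    obtain P Q where PQ: "eval2 Q p \<noteq> 0" "\<And>q. q \<in> W \<Longrightarrow> c p j q * eval2 Q q = eval2 P q"
      using c[OF p, of j] unfolding locally_rational_def by blast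
    have "b j q * eval2 (F p * Q) q = eval2 P q" if q: "q \<in> W" for q
    proof -
      have "eval2 (F p) q * b j q = c p j q"
        using True
      proof (rule binary_form_unique[rotated])
        fix x y
        show "(\<Sum>j\<le>m. eval2 (F p) q * b j q * x ^ j * y ^ (m - j)) = (\<Sum>j\<le>m. c p j q * x ^ j * y ^ (m - j))"
          unfolding eq[OF p q, symmetric] form[OF q] by (simp add: sum_distrib_left mult.assoc)
      qed
      then show ?thesis using PQ(2)[OF q] by (simp add: algebra_simps)
    qed
    then show ?thesis unfolding locally_rational_def
      using PQ(1) Fp[OF p] by (intro exI[of _ P] exI[of _ "F p * Q"]) simp
  next
    case False
    then show ?thesis unfolding locally_rational_def by (intro exI[of _ 0] exI[of _ 1]) (simp add: b_def)
  qed
  moreover have "b j (- q) = (-1) ^ m * b j q" if q: "q \<in> W" for j q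
  proof (cases "j \<le> m")
    case True
    have eq: "(-1) ^ m * b j (- q) = b j q"
      using True
    proof (rule binary_form_unique[rotated])
      fix x y :: complex
      have deriv: "cone_param_deriv (- q) (- x, - y) = cone_param_deriv q (x, y)"
        using cone_param_deriv_uminus[of q "(x, y)"] by simp
      have "(- x) ^ j * (- y) ^ (m - j) = (-1) ^ m * (x ^ j * y ^ (m - j))" if "j \<le> m" for j
        using that power_add[of "-1 :: complex" j "m - j"]
        unfolding power_minus[of x] power_minus[of y] by simp
      then have "(\<Sum>j\<le>m. (-1) ^ m * b j (- q) * x ^ j * y ^ (m - j)) =
          (\<Sum>j\<le>m. b j (- q) * (- x) ^ j * (- y) ^ (m - j))"
        by (intro sum.cong refl) (simp add: mult.assoc)
      also have "\<dots> = \<eta> (cone_param (- q)) (cone_param_deriv (- q) (- x, - y))"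
        using form[OF W_uminus[OF q]] by simp
      also have "\<dots> = (\<Sum>j\<le>m. b j q * x ^ j * y ^ (m - j))"
        unfolding deriv cone_param_uminus by (rule form[OF q])
      finally show "(\<Sum>j\<le>m. (-1) ^ m * b j (- q) * x ^ j * y ^ (m - j)) = \<dots>" .
    qed
    show ?thesis unfolding eq[symmetric] by simp
  qed (simp add: b_def)
  ultimately show thesis using form by (intro that[of b])
qed

end

section \<open>Global quotients in the coordinates (s, t) of a chart\<close>

definition rational_on :: "(complex \<times> complex) set \<Rightarrow> (complex \<times> complex \<Rightarrow> complex) set" where
  "rational_on Z = {f. \<exists>N D. \<forall>q\<in>Z. eval2 D q \<noteq> 0 \<and> f q = eval2 N q / eval2 D q}"

lemma rational_on_quotient:
  "(\<And>q. q \<in> Z \<Longrightarrow> eval2 D q \<noteq> 0) \<Longrightarrow> (\<lambda>q. eval2 N q / eval2 D q) \<in> rational_on Z"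
  unfolding rational_on_def by blast

lemma rational_on_eval2: "eval2 N \<in> rational_on Z"
  using rational_on_quotient[of Z 1 N] by simp

lemma function_subalgebra_rational_on: "function_subalgebra (rational_on Z)"
  unfolding function_subalgebra_def
proof (intro conjI allI ballI)
  fix c :: complex
  have "eval2 [:[:c:]:] = (\<lambda>_. c)" by (rule ext) (rule eval2_simps)
  then show "(\<lambda>_. c) \<in> rational_on Z" using rational_on_eval2 by metis
next
  fix f g assume "f \<in> rational_on Z" "g \<in> rational_on Z"
  then obtain N D N' D' where
    "\<forall>q\<in>Z. eval2 D q \<noteq> 0 \<and> f q = eval2 N q / eval2 D q"
    "\<forall>q\<in>Z. eval2 D' q \<noteq> 0 \<and> g q = eval2 N' q / eval2 D' q"
    unfolding rational_on_def by blast
  then have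
    "\<forall>q\<in>Z. eval2 (D * D') q \<noteq> 0 \<and> f q + g q = eval2 (N * D' + N' * D) q / eval2 (D * D') q"
    "\<forall>q\<in>Z. eval2 (D * D') q \<noteq> 0 \<and> f q * g q = eval2 (N * N') q / eval2 (D * D') q"
    unfolding eval2_simps by (metis add_frac_eq no_zero_divisors, metis times_divide_times_eq no_zero_divisors)
  then show "(\<lambda>q. f q + g q) \<in> rational_on Z" "(\<lambda>q. f q * g q) \<in> rational_on Z"
    unfolding rational_on_def by blast+
qed

context A1_neighbourhood
begin

text \<open>Substitutes q = u A(t), so that u runs along the line through the origin spanned by A(t)
  and changing the sign of u changes the sign of q. Parity then leaves functions of (u^2, t).
  Leaving \<open>A\<close> general treats all charts at once, and the denominators are nonzero also
  at s = 0, which is where Hartogs extension enters.\<close>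

lemma pullback_chart_coefficients:
  assumes eta: "regular_sym_diff m (X - {0}) \<eta>"
  fixes a0 a1 b0 b1 :: complex
  defines "A \<equiv> \<lambda>t. (a0 + a1 * t, b0 + b1 * t)"
  obtains N D where
    "\<And>j s t. s *s cone_param (A t) \<in> X \<Longrightarrow> eval2 (D j) (s, t) \<noteq> 0"
    "\<And>u t x y. cone_param (u * fst (A t), u * snd (A t)) \<in> X - {0} \<Longrightarrow>
       \<eta> (cone_param (u * fst (A t), u * snd (A t))) (cone_param_deriv (u * fst (A t), u * snd (A t)) (x, y)) =
       (\<Sum>j\<le>m. u ^ (m mod 2) * (eval2 (N j) (u\<^sup>2, t) / eval2 (D j) (u\<^sup>2, t)) * x ^ j * y ^ (m - j))"
proof -
  obtain b where b: "\<And>j p. p \<in> W \<Longrightarrow> locally_rational W p (b j)"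
    and form: "\<And>q x y. q \<in> W \<Longrightarrow>
       \<eta> (cone_param q) (cone_param_deriv q (x, y)) = (\<Sum>j\<le>m. b j q * x ^ j * y ^ (m - j))"
    and par: "\<And>j q. q \<in> W \<Longrightarrow> b j (- q) = (-1) ^ m * b j q"
    using pullback_form[OF eta] by blast
  obtain F where F: "eval2 F (0, 0) \<noteq> 0" "\<And>q. q \<noteq> (0, 0) \<Longrightarrow> eval2 F q \<noteq> 0 \<Longrightarrow> q \<in> W"
    using W_contains_basic by blast
  \<comment> \<open>Used with k = m for the numerator and k = 0 for the even denominator.\<close>
  have subst: "\<exists>S. \<forall>u t. eval2 P (u * fst (A t), u * snd (A t)) = u ^ (k mod 2) * eval2 S (u\<^sup>2, t)"
    if P: "\<And>q. eval2 P (- q) = (-1) ^ k * eval2 P q" for P k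
  proof -
    obtain R where R: "\<And>q. eval2 R q = eval2 P (fst q * fst (A (snd q)), fst q * snd (A (snd q)))"
      using eval2_compose[of P "[:0, 1:] * ([:[:a0:]:] + [:[:a1:]:] * [:[:0, 1:]:])"
        "[:0, 1:] * ([:[:b0:]:] + [:[:b1:]:] * [:[:0, 1:]:])"]
      unfolding eval2_simps A_def fst_conv snd_conv by blast
    have "eval2 R (- u, t) = (-1) ^ k * eval2 R (u, t)" for u t
      using P[of "(u * fst (A t), u * snd (A t))"] by (simp add: R)
    from eval2_parity_factor[OF this] show ?thesis by (simp add: R)
  qed
  have "\<exists>N D. (\<forall>s t. s *s cone_param (A t) \<in> X \<longrightarrow> eval2 D (s, t) \<noteq> 0) \<and>
      (\<forall>u t. (u * fst (A t), u * snd (A t)) \<in> W \<longrightarrow> b j (u * fst (A t), u * snd (A t)) =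
         u ^ (m mod 2) * (eval2 N (u\<^sup>2, t) / eval2 D (u\<^sup>2, t)))" for j
  proof -
    obtain Q P where nz: "\<And>p. p \<in> insert (0, 0) W \<Longrightarrow> eval2 Q p \<noteq> 0"
      and eq: "\<And>q. q \<in> W \<Longrightarrow> b j q * eval2 Q q = eval2 P q"
      and Q: "\<And>q. eval2 Q (- q) = eval2 Q q"
      and P: "\<And>q. eval2 P (- q) = (-1) ^ m * eval2 P q"
    proof (rule hartogs_rational_parity[of F W "b j" m, OF F(1)], goal_cases)
      case (1 q)
      from 1(2,3) show ?case by (rule F(2))
    next
      case (2 p)
      from 2(2) show ?case by (rule b)
    next
      case (3 q)
      from 3(2) show ?case by (rule W_uminus)
    next
      case (4 q)
      from 4(2) show ?case by (rule par)
    next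
      case (5 P Q)
      from 5(2-5) show ?case by (rule 5(1))
    qed
    obtain N where N: "\<And>u t. eval2 P (u * fst (A t), u * snd (A t)) = u ^ (m mod 2) * eval2 N (u\<^sup>2, t)"
      using subst[of P m] P by blast
    obtain D where D: "\<And>u t. eval2 Q (u * fst (A t), u * snd (A t)) = eval2 D (u\<^sup>2, t)"
      using subst[of Q 0] Q by auto
    have "eval2 D (s, t) \<noteq> 0" if "s *s cone_param (A t) \<in> X" for s t
    proof -
      \<comment> \<open>Any square root of s would do: \<open>D\<close> sees only its square. For s
        = 0 the point is the origin, covered by \<open>insert (0, 0) W\<close>.\<close>
      define q where "q = (csqrt s * fst (A t), csqrt s * snd (A t))"
      have "cone_param q = s *s cone_param (A t)"
        by (simp add: q_def vec_eq_iff forall_3 power_mult_distrib mult.assoc[symmetric]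
            mult.commute[of _ "csqrt s"] flip: power2_eq_square)
      with that have "q \<in> insert (0, 0) W" by (auto simp: W_def)
      from nz[OF this] show ?thesis by (simp add: q_def D)
    qed
    moreover have "b j (u * fst (A t), u * snd (A t)) =
        u ^ (m mod 2) * (eval2 N (u\<^sup>2, t) / eval2 D (u\<^sup>2, t))"
      if "(u * fst (A t), u * snd (A t)) \<in> W" for u t
      using eq[OF that] nz[of "(u * fst (A t), u * snd (A t))"] that
      unfolding N D by (simp add: eq_divide_eq)
    ultimately show ?thesis by blast
  qed
  then have "\<forall>j. \<exists>ND. (\<forall>s t. s *s cone_param (A t) \<in> X \<longrightarrow> eval2 (snd ND) (s, t) \<noteq> 0) \<and>
      (\<forall>u t. (u * fst (A t), u * snd (A t)) \<in> W \<longrightarrow> b j (u * fst (A t), u * snd (A t)) =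
         u ^ (m mod 2) * (eval2 (fst ND) (u\<^sup>2, t) / eval2 (snd ND) (u\<^sup>2, t)))"
    unfolding split_paired_Ex fst_conv snd_conv by blast
  from choice[OF this] obtain ND where
    nz: "\<And>j s t. s *s cone_param (A t) \<in> X \<Longrightarrow> eval2 (snd (ND j)) (s, t) \<noteq> 0"
    and bj: "\<And>j u t. (u * fst (A t), u * snd (A t)) \<in> W \<Longrightarrow> b j (u * fst (A t), u * snd (A t)) =
         u ^ (m mod 2) * (eval2 (fst (ND j)) (u\<^sup>2, t) / eval2 (snd (ND j)) (u\<^sup>2, t))"
    by blast
  show thesis
  proof (rule that[of "\<lambda>j. snd (ND j)" "\<lambda>j. fst (ND j)"])
    fix u t x y
    assume "cone_param (u * fst (A t), u * snd (A t)) \<in> X - {0}"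
    then have "(u * fst (A t), u * snd (A t)) \<in> W" by (simp add: W_def)
    from form[OF this] show "\<eta> (cone_param (u * fst (A t), u * snd (A t)))
        (cone_param_deriv (u * fst (A t), u * snd (A t)) (x, y)) =
       (\<Sum>j\<le>m. u ^ (m mod 2) * (eval2 (fst (ND j)) (u\<^sup>2, t) / eval2 (snd (ND j)) (u\<^sup>2, t)) * x ^ j * y ^ (m - j))"
      unfolding bj[OF \<open>_ \<in> W\<close>] .
  qed (rule nz)
qed

text \<open>In the coordinates (s, t) the blow-down is s times \<open>cone_param (A t)\<close>, and
  the vector fed to \<omega> is the image under its differential of (ds, dt) = (x, y). The resulting
  coefficients have no pole along s = 0.\<close>

lemma vanishing_chart_form:
  assumes eta: "regular_sym_diff m (X - {0}) \<eta>"
    and om: "sym_diff_eq (X - {0}) \<omega> (\<lambda>p v. h p ^ (m div 2) * \<eta> p v)"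
    and h: "h = (\<lambda>x. \<Sum>i\<in>UNIV. c $ i * x $ i)"
  fixes a0 a1 b0 b1 :: complex
  defines "A \<equiv> \<lambda>t. (a0 + a1 * t, b0 + b1 * t)"
  obtains N D where
    "\<And>j s t. s *s cone_param (A t) \<in> X \<Longrightarrow> eval2 (D j) (s, t) \<noteq> 0"
    "\<And>s t x y. s *s cone_param (A t) \<in> X - {0} \<Longrightarrow>
       \<omega> (s *s cone_param (A t)) (x *s cone_param (A t) + (s * y) *s cone_param_deriv (A t) (a1, b1)) =
       (\<Sum>j\<le>m. eval2 (N j) (s, t) / eval2 (D j) (s, t) * x ^ j * y ^ (m - j))"
proof -
  define Z where "Z = {q. fst q *s cone_param (A (snd q)) \<in> X}"
  define R where "R = rational_on Z"
  have R: "function_subalgebra R" unfolding R_def by (rule function_subalgebra_rational_on)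
  obtain D N where D: "\<And>j s t. s *s cone_param (A t) \<in> X \<Longrightarrow> eval2 (D j) (s, t) \<noteq> 0"
    and form: "\<And>u t x y. cone_param (u * fst (A t), u * snd (A t)) \<in> X - {0} \<Longrightarrow>
       \<eta> (cone_param (u * fst (A t), u * snd (A t))) (cone_param_deriv (u * fst (A t), u * snd (A t)) (x, y)) =
       (\<Sum>j\<le>m. u ^ (m mod 2) * (eval2 (N j) (u\<^sup>2, t) / eval2 (D j) (u\<^sup>2, t)) * x ^ j * y ^ (m - j))"
    unfolding A_def
  proof (rule pullback_chart_coefficients[OF eta, of a0 a1 b0 b1], goal_cases)
    case (1 N D)
    from 1(2-3) show ?case by (rule 1(1))
  qed
  define PA QA where "PA = [:[:a0:]:] + [:[:a1:]:] * [:[:0, 1:]:]" and "QA = [:[:b0:]:] + [:[:b1:]:] * [:[:0, 1:]:]"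
  have PA: "eval2 PA q = fst (A (snd q))" and QA: "eval2 QA q = snd (A (snd q))" for q
    unfolding PA_def QA_def eval2_simps by (simp_all add: A_def)
  define H where "H = [:[:c $ 1:]:] * PA ^ 2 + [:[:c $ 2:]:] * (PA * QA) + [:[:c $ 3:]:] * QA ^ 2"
  have H: "eval2 H q = h (cone_param (A (snd q)))" for q
    unfolding H_def eval2_simps eval2_power PA QA by (simp add: h sum_3)
  define G where "G j = H ^ (m div 2) * N j" for j
  \<comment> \<open>The constant is what is left of (2u)^m once u^m has cancelled.\<close>
  define E where "E j = [:[:2 ^ m:]:] * D j" for j
  have E: "eval2 (E j) q = 2 ^ m * eval2 (D j) q" for j q by (simp only: E_def eval2_simps)
  have GR: "(\<lambda>q. eval2 (G j) q / eval2 (E j) q) \<in> R" for j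
    unfolding R_def by (rule rational_on_quotient) (use D in \<open>auto simp: E Z_def\<close>)
  \<comment> \<open>The two linear forms are 2u times the differentials of the plane coordinates of
    u A(t); after this scaling they involve only s and t.\<close>
  have "binary_form R Z m (\<lambda>q x y. \<Sum>j\<le>m.
      (eval2 PA q * x + eval2 ([:[:2 * a1:]:] * [:0, 1:]) q * y) ^ j *
      ((eval2 QA q * x + eval2 ([:[:2 * b1:]:] * [:0, 1:]) q * y) ^ (m - j) *
       (eval2 (G j) q / eval2 (E j) q)))"
  proof (rule binary_form_sum[OF R])
    fix j assume "j \<in> {..m}"
    then have m: "m = j + (m - j + 0)" by simp
    show "binary_form R Z m (\<lambda>q x y.
      (eval2 PA q * x + eval2 ([:[:2 * a1:]:] * [:0, 1:]) q * y) ^ j *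
      ((eval2 QA q * x + eval2 ([:[:2 * b1:]:] * [:0, 1:]) q * y) ^ (m - j) *
       (eval2 (G j) q / eval2 (E j) q)))"
      by (subst m, intro binary_form_mult_linear_power R binary_form_const GR)
        (simp_all only: R_def rational_on_eval2)
  qed
  then obtain C where CR: "\<And>j. C j \<in> R" and C: "\<And>q x y. q \<in> Z \<Longrightarrow> (\<Sum>j\<le>m.
      (eval2 PA q * x + eval2 ([:[:2 * a1:]:] * [:0, 1:]) q * y) ^ j *
      ((eval2 QA q * x + eval2 ([:[:2 * b1:]:] * [:0, 1:]) q * y) ^ (m - j) *
       (eval2 (G j) q / eval2 (E j) q))) = (\<Sum>j\<le>m. C j q * x ^ j * y ^ (m - j))"
    unfolding binary_form_def by blast
  have "\<forall>j. \<exists>ND. \<forall>q\<in>Z. eval2 (snd ND) q \<noteq> 0 \<and> C j q = eval2 (fst ND) q / eval2 (snd ND) q"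
    using CR unfolding R_def rational_on_def split_paired_Ex fst_conv snd_conv by blast
  from choice[OF this] obtain ND where ND: "\<And>j q. q \<in> Z \<Longrightarrow> eval2 (snd (ND j)) q \<noteq> 0"
    "\<And>j q. q \<in> Z \<Longrightarrow> C j q = eval2 (fst (ND j)) q / eval2 (snd (ND j)) q"
    by blast
  show thesis
  proof (rule that[of "\<lambda>j. snd (ND j)" "\<lambda>j. fst (ND j)"])
    fix j s t assume "s *s cone_param (A t) \<in> X"
    then show "eval2 (snd (ND j)) (s, t) \<noteq> 0" by (intro ND) (simp add: Z_def)
  next
    fix s t x y
    assume sX: "s *s cone_param (A t) \<in> X - {0}"
    define \<alpha> \<beta> u where "\<alpha> = fst (A t)" and "\<beta> = snd (A t)" and "u = csqrt s"
    have u2: "u\<^sup>2 = s" by (simp add: u_def)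
    have u: "u \<noteq> 0" using sX by (auto simp: u_def)
    have cp: "cone_param (u * \<alpha>, u * \<beta>) = s *s cone_param (A t)"
      by (simp add: vec_eq_iff forall_3 \<alpha>_def \<beta>_def u2[symmetric] power2_eq_square)
    \<comment> \<open>The differential of u A(t), with du = ds/(2u) and u = 2s/(2u) to reach a
      common denominator.\<close>
    define r1 r2 where "r1 = (\<alpha> * x + 2 * a1 * s * y) / (2 * u)" and "r2 = (\<beta> * x + 2 * b1 * s * y) / (2 * u)"
    have dcp: "cone_param_deriv (u * \<alpha>, u * \<beta>) (r1, r2) =
        x *s cone_param (A t) + (s * y) *s cone_param_deriv (A t) (a1, b1)"
      using u by (simp add: vec_eq_iff forall_3 r1_def r2_def \<alpha>_def \<beta>_def field_simps power2_eq_square)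
    have qW: "(u * \<alpha>, u * \<beta>) \<in> W" unfolding W_def mem_Collect_eq cp by (rule sX)
    \<comment> \<open>Since \<open>h\<close> is linear without constant term, each power of
      \<open>h\<close> supplies one factor s = u^2.\<close>
    have hs: "h (s *s cone_param (A t)) = s * h (cone_param (A t))"
      by (simp add: h sum_3 algebra_simps)
    have "u ^ m = u ^ (2 * (m div 2) + m mod 2)" by simp
    then have um: "s ^ (m div 2) * u ^ (m mod 2) = u ^ m"
      unfolding power_add power_mult u2 by simp
    have "\<omega> (s *s cone_param (A t)) (x *s cone_param (A t) + (s * y) *s cone_param_deriv (A t) (a1, b1))
      = h (s *s cone_param (A t)) ^ (m div 2) *
        \<eta> (cone_param (u * \<alpha>, u * \<beta>)) (cone_param_deriv (u * \<alpha>, u * \<beta>) (r1, r2))"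
      using om[unfolded sym_diff_eq_def, rule_format, OF sX, unfolded cp[symmetric], 
          OF cone_param_deriv_tangent[OF qW, of "(r1, r2)"]]
      unfolding dcp cp .
    also have "\<dots> = (s * h (cone_param (A t))) ^ (m div 2) * (\<Sum>j\<le>m. u ^ (m mod 2) *
        (eval2 (N j) (s, t) / eval2 (D j) (s, t)) * r1 ^ j * r2 ^ (m - j))"
      using form[of u t r1 r2] sX cp unfolding u2 \<alpha>_def[symmetric] \<beta>_def[symmetric] hs by simp
    also have "\<dots> = (\<Sum>j\<le>m. (\<alpha> * x + 2 * a1 * s * y) ^ j * ((\<beta> * x + 2 * b1 * s * y) ^ (m - j) *
       (eval2 (G j) (s, t) / eval2 (E j) (s, t))))"
      unfolding sum_distrib_left
    proof (intro sum.cong refl)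
      fix j assume "j \<in> {..m}"
      then have "(2 * u) ^ j * (2 * u) ^ (m - j) = (2 * u) ^ m"
        unfolding power_add[symmetric] by simp
      then have r: "r1 ^ j * r2 ^ (m - j) =
          (\<alpha> * x + 2 * a1 * s * y) ^ j * (\<beta> * x + 2 * b1 * s * y) ^ (m - j) / (2 * u) ^ m"
        unfolding r1_def r2_def power_divide times_divide_times_eq by simp
      have nz: "eval2 (D j) (s, t) \<noteq> 0" using D sX by blast
      have "(s * h (cone_param (A t))) ^ (m div 2) * (u ^ (m mod 2) *
        (eval2 (N j) (s, t) / eval2 (D j) (s, t)) * r1 ^ j * r2 ^ (m - j)) =
        (s ^ (m div 2) * u ^ (m mod 2)) * (eval2 (G j) (s, t) / eval2 (D j) (s, t)) *
          (r1 ^ j * r2 ^ (m - j))"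
        unfolding G_def eval2_simps eval2_power H snd_conv power_mult_distrib
        by (simp only: times_divide_eq_left times_divide_eq_right mult_ac)
      also have "\<dots> = (\<alpha> * x + 2 * a1 * s * y) ^ j * ((\<beta> * x + 2 * b1 * s * y) ^ (m - j) *
       (eval2 (G j) (s, t) / eval2 (E j) (s, t)))"
        unfolding um r E power_mult_distrib using u nz by (simp add: divide_simps)
      finally show "(s * h (cone_param (A t))) ^ (m div 2) * (u ^ (m mod 2) *
        (eval2 (N j) (s, t) / eval2 (D j) (s, t)) * r1 ^ j * r2 ^ (m - j)) = \<dots>" .
    qed
    also have "\<dots> = (\<Sum>j\<le>m. C j (s, t) * x ^ j * y ^ (m - j))"
    proof -
      have "(s, t) \<in> Z" using sX by (simp add: Z_def)
      from C[OF this, of x y] show ?thesis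
        unfolding eval2_simps PA QA by (simp add: \<alpha>_def \<beta>_def)
    qed
    also have "\<dots> = (\<Sum>j\<le>m. eval2 (fst (ND j)) (s, t) / eval2 (snd (ND j)) (s, t) * x ^ j * y ^ (m - j))"
      using sX by (simp add: ND(2) Z_def)
    finally show "\<omega> (s *s cone_param (A t)) (x *s cone_param (A t) + (s * y) *s cone_param_deriv (A t) (a1, b1))
      = \<dots>" .
  qed
qed

end

section \<open>Charts of the blow-up\<close>

lemma base_pt_pair_vec [simp]: "base_pt (pair_vec x z) = x"
  and direction_pair_vec [simp]: "direction (pair_vec x z) = z"
  by (simp_all add: base_pt_def direction_def pair_vec_def vec_eq_iff)

lemma base_pt_nth [simp]: "base_pt p $ a = p $ Inl a"
  and direction_nth [simp]: "direction p $ a = p $ Inr a"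
  by (simp_all add: base_pt_def direction_def)

lemma pair_vec_nth [simp]: "pair_vec x z $ Inl a = x $ a" "pair_vec x z $ Inr a = z $ a"
  by (simp_all add: pair_vec_def)

lemma has_derivative_vec:
  fixes f :: "'a::euclidean_space \<Rightarrow> 'b::real_normed_vector ^ 'n::finite"
  assumes "\<And>i. ((\<lambda>x. f x $ i) has_derivative (\<lambda>v. f' v $ i)) (at p)"
  shows "(f has_derivative f') (at p)"
  unfolding has_derivative_def
proof
  have lin: "linear (\<lambda>v. f' v $ i)" for i
    using has_derivative_linear[OF assms] .
  have "linear f'"
    by (rule linearI) (simp_all add: vec_eq_iff linear_add[OF lin] linear_scale[OF lin])
  then show "bounded_linear f'" by (simp add: linear_conv_bounded_linear)
  show "((\<lambda>y. ((f y - f (Lim (at p) (\<lambda>x. x))) - f' (y - Lim (at p) (\<lambda>x. x))) /\<^sub>R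
      norm (y - Lim (at p) (\<lambda>x. x))) \<longlongrightarrow> 0) (at p)"
    using assms unfolding has_derivative_def by (intro vec_tendstoI) simp
qed

text \<open>The equations z_i = 1, z_1 z_3 = z_2^2 and x = x_i z of the chart, for z =
  \<open>direction p\<close> and x = \<open>base_pt p\<close>, together with their differentials at
  \<open>w\<close>.\<close>

definition chart_tangent :: "3 \<Rightarrow> complex ^ (3 + 3) \<Rightarrow> complex ^ (3 + 3) \<Rightarrow> bool" where
  "chart_tangent i p w \<longleftrightarrow>
     direction p $ i = 1 \<and> direction p \<in> quadric_cone \<and>
     base_pt p = base_pt p $ i *s direction p \<and>
     direction w $ i = 0 \<and>
     direction p $ 1 * direction w $ 3 + direction p $ 3 * direction w $ 1 =
       2 * direction p $ 2 * direction w $ 2 \<and>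
     base_pt w = base_pt w $ i *s direction p + base_pt p $ i *s direction w"

lemma tendsto_pair_vec [tendsto_intros]:
  assumes "(f \<longlongrightarrow> x) F" "(g \<longlongrightarrow> z) F"
  shows "((\<lambda>e. pair_vec (f e) (g e)) \<longlongrightarrow> pair_vec x z) F"
proof (rule vec_tendstoI)
  fix k
  show "((\<lambda>e. pair_vec (f e) (g e) $ k) \<longlongrightarrow> pair_vec x z $ k) F"
    by (cases k) (auto intro: tendsto_vec_nth assms)
qed

lemma pair_vec_base_direction: "pair_vec (base_pt p) (direction p) = p"
  by (simp add: pair_vec_def vec_eq_iff split: sum.split)

text \<open>With the zero vector, \<open>chart_tangent\<close> yields the equations of the point
  alone.\<close>

lemma zero_in_tangent_space: "0 \<in> tangent_space V p"
  unfolding tangent_space_def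
  using poly_fun_differentiable linear_frechet_derivative linear_0 by blast

text \<open>An equation checked only on points (x, x / x_i) of \<open>V\<close> passes to the
  Zariski closure, and its differential then kills tangent vectors by definition.\<close>

lemma blowup_chart_equation:
  assumes f: "poly_fun f" and van: "\<And>x. x \<in> V \<Longrightarrow> x $ i \<noteq> 0 \<Longrightarrow> f (pair_vec x ((1 / x $ i) *s x)) = 0"
    and p: "p \<in> blowup_chart V i"
  shows "f p = 0"
    and "(f has_derivative f') (at p) \<Longrightarrow> w \<in> tangent_space (blowup_chart V i) p \<Longrightarrow> f' w = 0"
proof -
  have 0: "f q = 0" if "q \<in> blowup_chart V i" for q
    using that f van unfolding blowup_chart_def zariski_closure_def by blast
  show "f p = 0" using 0 p .
  assume "(f has_derivative f') (at p)" "w \<in> tangent_space (blowup_chart V i) p"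
  moreover from this(1) have "f' = frechet_derivative f (at p)" by (rule frechet_derivative_at)
  ultimately show "f' w = 0" using f 0 unfolding tangent_space_def by blast
qed

lemma poly_fun_diff:
  assumes "poly_fun f" "poly_fun g"
  shows "poly_fun (\<lambda>x. f x - g x)"
  using poly_fun.add[OF assms(1) poly_fun.mult[OF poly_fun.const[of "-1"] assms(2)]] by simp

lemma chart_tangent_blowup_chart:
  assumes V: "V \<subseteq> quadric_cone" and p: "p \<in> blowup_chart V i"
    and w: "w \<in> tangent_space (blowup_chart V i) p"
  shows "chart_tangent i p w"
proof -
  have d: "((\<lambda>p :: complex ^ (3 + 3). p $ a) has_derivative (\<lambda>v. v $ a)) (at p)" for a
    by (intro bounded_linear_imp_has_derivative bounded_linear_vec_nth)
  have 1: "p $ Inr i - 1 = 0" "w $ Inr i = 0"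
  proof -
    have f: "poly_fun (\<lambda>p :: complex ^ (3 + 3). p $ Inr i - 1)"
      by (intro poly_fun_diff poly_fun.coord poly_fun.const)
    have van: "pair_vec x ((1 / x $ i) *s x) $ Inr i - 1 = 0" if "x $ i \<noteq> 0" for x
      using that by simp
    show "p $ Inr i - 1 = 0"
      by (rule blowup_chart_equation(1)[OF f van p])
    have "((\<lambda>p :: complex ^ (3 + 3). p $ Inr i - 1) has_derivative (\<lambda>v. v $ Inr i - 0)) (at p)"
      by (intro has_derivative_diff has_derivative_const d)
    from blowup_chart_equation(2)[OF f van p this w] show "w $ Inr i = 0" by simp
  qed
  have 2: "p $ Inr 1 * p $ Inr 3 - p $ Inr 2 * p $ Inr 2 = 0"
    "p $ Inr 1 * w $ Inr 3 + w $ Inr 1 * p $ Inr 3 -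
      (p $ Inr 2 * w $ Inr 2 + w $ Inr 2 * p $ Inr 2) = 0"
  proof -
    have f: "poly_fun (\<lambda>p :: complex ^ (3 + 3). p $ Inr 1 * p $ Inr 3 - p $ Inr 2 * p $ Inr 2)"
      by (intro poly_fun_diff poly_fun.mult poly_fun.coord)
    have van: "pair_vec x ((1 / x $ i) *s x) $ Inr 1 * pair_vec x ((1 / x $ i) *s x) $ Inr 3 -
        pair_vec x ((1 / x $ i) *s x) $ Inr 2 * pair_vec x ((1 / x $ i) *s x) $ Inr 2 = 0"
      if "x \<in> V" for x
      using that V by (auto simp: quadric_cone_def power2_eq_square)
    show "p $ Inr 1 * p $ Inr 3 - p $ Inr 2 * p $ Inr 2 = 0"
      by (rule blowup_chart_equation(1)[OF f van p])
    show "p $ Inr 1 * w $ Inr 3 + w $ Inr 1 * p $ Inr 3 -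
      (p $ Inr 2 * w $ Inr 2 + w $ Inr 2 * p $ Inr 2) = 0"
      by (rule blowup_chart_equation(2)[OF f van p _ w])
        (assumption, intro has_derivative_diff has_derivative_mult d)
  qed
  have 3: "p $ Inl a - p $ Inl i * p $ Inr a = 0"
    "w $ Inl a - (p $ Inl i * w $ Inr a + w $ Inl i * p $ Inr a) = 0" for a
  proof -
    have f: "poly_fun (\<lambda>p :: complex ^ (3 + 3). p $ Inl a - p $ Inl i * p $ Inr a)"
      by (intro poly_fun_diff poly_fun.mult poly_fun.coord)
    have van: "pair_vec x ((1 / x $ i) *s x) $ Inl a -
        pair_vec x ((1 / x $ i) *s x) $ Inl i * pair_vec x ((1 / x $ i) *s x) $ Inr a = 0"
      if "x $ i \<noteq> 0" for x
      using that by simp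
    show "p $ Inl a - p $ Inl i * p $ Inr a = 0"
      by (rule blowup_chart_equation(1)[OF f van p])
    show "w $ Inl a - (p $ Inl i * w $ Inr a + w $ Inl i * p $ Inr a) = 0"
      by (rule blowup_chart_equation(2)[OF f van p _ w])
        (assumption, intro has_derivative_diff has_derivative_mult d)
  qed
  show ?thesis
    unfolding chart_tangent_def
  proof (intro conjI)
    show "direction p $ i = 1" "direction w $ i = 0" using 1 by simp_all
    show "direction p \<in> quadric_cone" using 2(1) by (simp add: quadric_cone_def power2_eq_square)
    show "base_pt p = base_pt p $ i *s direction p"
      unfolding vec_eq_iff
    proof
      fix a
      show "base_pt p $ a = (base_pt p $ i *s direction p) $ a"
        using 3(1)[of a] by simp
    qed
    show "direction p $ 1 * direction w $ 3 + direction p $ 3 * direction w $ 1 =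
       2 * direction p $ 2 * direction w $ 2"
      using 2(2) by (simp add: mult.commute)
    show "base_pt w = base_pt w $ i *s direction p + base_pt p $ i *s direction w"
      unfolding vec_eq_iff
    proof
      fix a
      show "base_pt w $ a = (base_pt w $ i *s direction p + base_pt p $ i *s direction w) $ a"
        using 3(2)[of a] by simp
    qed
  qed
qed

definition chart_change_deriv ::
    "3 \<Rightarrow> complex ^ (3 + 3) \<Rightarrow> complex ^ (3 + 3) \<Rightarrow> complex ^ (3 + 3)" where
  "chart_change_deriv j p w = pair_vec (base_pt w)
     ((1 / direction p $ j) *s direction w -
      (direction w $ j / (direction p $ j)\<^sup>2) *s direction p)"

lemma chart_change_has_derivative:
  assumes "direction p $ j \<noteq> 0"
  shows "(chart_change j has_derivative chart_change_deriv j p) (at p)"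
proof (rule has_derivative_vec)
  have d: "((\<lambda>p :: complex ^ (3 + 3). p $ a) has_derivative (\<lambda>v. v $ a)) (at p)" for a
    by (intro bounded_linear_imp_has_derivative bounded_linear_vec_nth)
  fix k :: "3 + 3"
  show "((\<lambda>x. chart_change j x $ k) has_derivative (\<lambda>v. chart_change_deriv j p v $ k)) (at p)"
  proof (cases k)
    case (Inl a)
    then show ?thesis using d by (simp add: chart_change_def chart_change_deriv_def)
  next
    case (Inr a)
    have "((\<lambda>x. x $ Inr a / x $ Inr j) has_derivative
        (\<lambda>v. (v $ Inr a * p $ Inr j - p $ Inr a * v $ Inr j) / (p $ Inr j * p $ Inr j))) (at p)"
      using assms by (intro has_derivative_divide' d) simp
    also have "(\<lambda>v. (v $ Inr a * p $ Inr j - p $ Inr a * v $ Inr j) / (p $ Inr j * p $ Inr j)) =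
        (\<lambda>v. chart_change_deriv j p v $ k)"
      using assms Inr by (simp add: chart_change_deriv_def fun_eq_iff field_simps power2_eq_square)
    finally show ?thesis using Inr by (simp add: chart_change_def)
  qed
qed

lemma frechet_derivative_base_pt: "frechet_derivative base_pt (at p) = base_pt"
proof -
  have "(base_pt has_derivative base_pt) (at p)"
    by (rule has_derivative_vec)
      (simp add: bounded_linear_imp_has_derivative bounded_linear_vec_nth)
  then show ?thesis by (rule frechet_derivative_at[symmetric])
qed

text \<open>Proved by algebra on the equations, since the gluing argument applies it to auxiliary
  pairs that are known only to satisfy \<open>chart_tangent\<close>.\<close>

lemma chart_tangent_chart_change:
  assumes t: "chart_tangent i p w" and j: "direction p $ j \<noteq> 0"
  shows "chart_tangent j (chart_change j p) (chart_change_deriv j p w)"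
proof -
  define z dz r dr where "z = direction p" and "dz = direction w"
    and "r = base_pt p $ i" and "dr = base_pt w $ i"
  have x: "base_pt p $ a = r * z $ a" "base_pt w $ a = dr * z $ a + r * dz $ a" for a
  proof -
    have "base_pt p = r *s z" "base_pt w = dr *s z + r *s dz"
      using t unfolding chart_tangent_def r_def dr_def z_def dz_def by blast+
    then show "base_pt p $ a = r * z $ a" "base_pt w $ a = dr * z $ a + r * dz $ a"
      by (simp_all del: base_pt_nth)
  qed
  have z: "z $ 1 * z $ 3 = (z $ 2)\<^sup>2" "z $ 1 * dz $ 3 + z $ 3 * dz $ 1 = 2 * z $ 2 * dz $ 2"
    using t unfolding chart_tangent_def quadric_cone_def z_def dz_def by blast+
  have zj: "z $ j \<noteq> 0" using j by (simp add: z_def)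
  \<comment> \<open>The quotient rule turns the differentiated cone equation into itself times c^-2,
    plus a multiple of the cone equation.\<close>
  have e: "(1 / c) * z1 * ((1 / c) * d3 - (d / c\<^sup>2) * z3) + (1 / c) * z3 * ((1 / c) * d1 - (d / c\<^sup>2) * z1)
    = 2 * ((1 / c) * z2) * ((1 / c) * d2 - (d / c\<^sup>2) * z2)"
    if "z1 * z3 = z2\<^sup>2" "z1 * d3 + z3 * d1 = 2 * z2 * d2" "c \<noteq> 0" for z1 z2 z3 d1 d2 d3 c d :: complex
  proof -
    have "(1 / c) * z1 * ((1 / c) * d3 - (d / c\<^sup>2) * z3) + (1 / c) * z3 * ((1 / c) * d1 - (d / c\<^sup>2) * z1)
      = (1 / c)\<^sup>2 * (z1 * d3 + z3 * d1) - 2 * (d / c ^ 3) * (z1 * z3)"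
      using that(3) by (simp add: field_simps power2_eq_square power3_eq_cube)
    also have "\<dots> = 2 * ((1 / c) * z2) * ((1 / c) * d2 - (d / c\<^sup>2) * z2)"
      unfolding that(1,2) using that(3) by (simp add: field_simps power2_eq_square power3_eq_cube)
    finally show ?thesis .
  qed
  show ?thesis
    unfolding chart_tangent_def chart_change_def chart_change_deriv_def
      base_pt_pair_vec direction_pair_vec z_def[symmetric] dz_def[symmetric]
  proof (intro conjI)
    show "(1 / z $ j) *s z \<in> quadric_cone"
      using z(1) by (simp add: quadric_cone_def power2_eq_square)
    show "base_pt p = base_pt p $ j *s ((1 / z $ j) *s z)"
      using zj by (simp add: vec_eq_iff x del: base_pt_nth)
    show "((1 / z $ j) *s dz - (dz $ j / (z $ j)\<^sup>2) *s z) $ j = 0"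
      using zj by (simp add: power2_eq_square)
    show "base_pt w = base_pt w $ j *s ((1 / z $ j) *s z) +
        base_pt p $ j *s ((1 / z $ j) *s dz - (dz $ j / (z $ j)\<^sup>2) *s z)"
      unfolding vec_eq_iff
    proof
      fix a
      have "dr * z $ a + r * dz $ a = (dr * z $ j + r * dz $ j) * ((1 / z $ j) * z $ a) +
          r * z $ j * ((1 / z $ j) * dz $ a - (dz $ j / (z $ j)\<^sup>2) * z $ a)"
        using zj by (simp add: field_simps power2_eq_square)
      then show "base_pt w $ a = (base_pt w $ j *s ((1 / z $ j) *s z) +
        base_pt p $ j *s ((1 / z $ j) *s dz - (dz $ j / (z $ j)\<^sup>2) *s z)) $ a"
        by (simp only: vector_add_component vector_minus_component vector_smult_component x)
    qed
    show "((1 / z $ j) *s z) $ 1 * ((1 / z $ j) *s dz - (dz $ j / (z $ j)\<^sup>2) *s z) $ 3 +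
      ((1 / z $ j) *s z) $ 3 * ((1 / z $ j) *s dz - (dz $ j / (z $ j)\<^sup>2) *s z) $ 1 =
      2 * ((1 / z $ j) *s z) $ 2 * ((1 / z $ j) *s dz - (dz $ j / (z $ j)\<^sup>2) *s z) $ 2"
      using e[OF z zj, of "dz $ j"] by simp
  qed (use zj in simp)
qed

text \<open>Rewrites the sum over j as a sum over multi-indices: those supported on \<open>k\<close>
  and \<open>l\<close> get the given coefficients, all others get 0.\<close>

lemma regular_sym_diff_binary:
  fixes k l :: "'n::finite"
  assumes kl: "k \<noteq> l" and c: "\<And>j. regular_on V (c j)"
  shows "regular_sym_diff m V (\<lambda>p w. \<Sum>j\<le>m. c j p * (w $ k) ^ j * (w $ l) ^ (m - j))"
proof -
  define mon where "mon j = (\<lambda>i. if i = k then j else if i = l then m - j else 0)" for j :: nat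
  define a where "a \<alpha> = (if \<alpha> \<in> mon ` {..m} then c (\<alpha> k) else (\<lambda>_. 0))" for \<alpha>
  have zero: "regular_on V (\<lambda>_. 0)"
    unfolding regular_on_def
    by (intro ballI exI[of _ UNIV] exI[of _ "\<lambda>_. 0"] exI[of _ "\<lambda>_. 1"])
      (simp add: zariski_open_UNIV poly_fun.const)
  have reg: "regular_on V (a \<alpha>)" for \<alpha>
    using c zero by (simp add: a_def)
  have inj: "inj_on mon {..m}"
    by (auto simp: inj_on_def mon_def fun_eq_iff split: if_splits)
  have deg: "(\<Sum>i\<in>UNIV. mon j i) = m" if "j \<le> m" for j
  proof -
    have "(\<Sum>i\<in>UNIV. mon j i) = (\<Sum>i\<in>{k, l}. mon j i)"
      by (intro sum.mono_neutral_right) (auto simp: mon_def)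
    then show ?thesis using kl that by (simp add: mon_def)
  qed
  have fin: "finite {\<alpha> :: 'n \<Rightarrow> nat. (\<Sum>i\<in>UNIV. \<alpha> i) = m}"
  proof (rule finite_subset)
    show "{\<alpha> :: 'n \<Rightarrow> nat. (\<Sum>i\<in>UNIV. \<alpha> i) = m} \<subseteq> UNIV \<rightarrow>\<^sub>E {..m}"
      by (auto simp: PiE_UNIV_domain intro: member_le_sum)
  qed (simp add: finite_PiE)
  have eq: "(\<Sum>j\<le>m. c j p * (w $ k) ^ j * (w $ l) ^ (m - j)) =
      (\<Sum>\<alpha> | (\<Sum>i\<in>UNIV. \<alpha> i) = m. a \<alpha> p * (\<Prod>i\<in>UNIV. (w $ i) ^ \<alpha> i))" for p w
  proof -
    have "(\<Sum>\<alpha> | (\<Sum>i\<in>UNIV. \<alpha> i) = m. a \<alpha> p * (\<Prod>i\<in>UNIV. (w $ i) ^ \<alpha> i)) =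
        (\<Sum>\<alpha>\<in>mon ` {..m}. a \<alpha> p * (\<Prod>i\<in>UNIV. (w $ i) ^ \<alpha> i))"
      using fin deg by (intro sum.mono_neutral_right) (auto simp: a_def)
    also have "\<dots> = (\<Sum>j\<le>m. a (mon j) p * (\<Prod>i\<in>UNIV. (w $ i) ^ mon j i))"
      by (simp add: sum.reindex[OF inj])
    also have "\<dots> = (\<Sum>j\<le>m. c j p * (w $ k) ^ j * (w $ l) ^ (m - j))"
    proof (intro sum.cong refl)
      fix j assume j: "j \<in> {..m}"
      have "(\<Prod>i\<in>UNIV. (w $ i) ^ mon j i) = (\<Prod>i\<in>{k, l}. (w $ i) ^ mon j i)"
        by (intro prod.mono_neutral_right) (auto simp: mon_def)
      moreover have "a (mon j) = c j" using j by (auto simp: a_def mon_def)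
      ultimately show "a (mon j) p * (\<Prod>i\<in>UNIV. (w $ i) ^ mon j i) =
          c j p * (w $ k) ^ j * (w $ l) ^ (m - j)"
        using kl by (simp add: mon_def)
    qed
    finally show ?thesis by simp
  qed
  show ?thesis
    unfolding regular_sym_diff_def
    by (intro ballI exI[of _ UNIV] exI[of _ a])
      (simp add: zariski_open_UNIV reg eq)
qed

text \<open>Coordinates $(s,t)$ of a chart. Chart 2 lies in chart 1, since $z_1z_3 = z_2^2 = 1$ there, and
  takes over its coordinates: $s = x_1$ and $t = z_2/z_1 = z_3$.\<close>

definition chart_coords :: "3 \<Rightarrow> complex ^ (3 + 3) \<Rightarrow> complex \<times> complex" where
  "chart_coords i p = (p $ Inl (if i = 3 then 3 else 1), p $ Inr (if i = 2 then 3 else 2))"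

lemma tendsto_vector_scalar_mult [tendsto_intros]:
  fixes z :: "complex ^ 'n::finite"
  shows "(f \<longlongrightarrow> c) F \<Longrightarrow> ((\<lambda>e. f e *s z) \<longlongrightarrow> c *s z) F"
  by (intro vec_tendstoI) (simp add: tendsto_mult_right)

lemma tendsto_chart_coords [tendsto_intros]:
  "(f \<longlongrightarrow> p) F \<Longrightarrow> ((\<lambda>e. chart_coords i (f e)) \<longlongrightarrow> chart_coords i p) F"
  unfolding chart_coords_def by (intro tendsto_intros)

text \<open>Start and step give the affine family A(t): (1, t) in charts 1 and 2, (t, 1) in chart 3.
  The step is also the derivative of A.\<close>

definition slope_start :: "3 \<Rightarrow> complex \<times> complex" where
  "slope_start i = (if i = 3 then (0, 1) else (1, 0))"

definition slope_step :: "3 \<Rightarrow> complex \<times> complex" where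
  "slope_step i = (if i = 3 then (1, 0) else (0, 1))"

definition slope_pair :: "3 \<Rightarrow> complex \<Rightarrow> complex \<times> complex" where
  "slope_pair i t = (fst (slope_start i) + fst (slope_step i) * t, snd (slope_start i) + snd (slope_step i) * t)"

text \<open>Identifies the blow-down and its differential in the coordinates (s, t) with the
  expressions on which \<omega> has been computed.\<close>

lemma chart_coords_param:
  assumes T: "chart_tangent i p w"
  defines "s \<equiv> fst (chart_coords i p)" and "t \<equiv> snd (chart_coords i p)"
    and "x \<equiv> fst (chart_coords i w)" and "y \<equiv> snd (chart_coords i w)"
  shows "base_pt p = s *s cone_param (slope_pair i t)"
    and "base_pt w = x *s cone_param (slope_pair i t) + (s * y) *s cone_param_deriv (slope_pair i t) (slope_step i)"
proof -
  define r dr where "r = base_pt p $ i" and "dr = base_pt w $ i"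
  have pa: "p $ Inl a = r * p $ Inr a" and wa: "w $ Inl a = dr * p $ Inr a + r * w $ Inr a" for a
  proof -
    have "base_pt p = r *s direction p" "base_pt w = dr *s direction p + r *s direction w"
      using T unfolding chart_tangent_def r_def dr_def by blast+
    then show "p $ Inl a = r * p $ Inr a" "w $ Inl a = dr * p $ Inr a + r * w $ Inr a"
      by (simp_all add: vec_eq_iff)
  qed
  have z: "p $ Inr 1 * p $ Inr 3 = (p $ Inr 2)\<^sup>2" "p $ Inr i = 1" "w $ Inr i = 0"
    "p $ Inr 1 * w $ Inr 3 + p $ Inr 3 * w $ Inr 1 = 2 * p $ Inr 2 * w $ Inr 2"
    using T unfolding chart_tangent_def quadric_cone_def by simp_all
  consider "i = 1" | "i = 2" | "i = 3" using exhaust_3 by blast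
  then have "base_pt p = s *s cone_param (slope_pair i t) \<and>
    base_pt w = x *s cone_param (slope_pair i t) + (s * y) *s cone_param_deriv (slope_pair i t) (slope_step i)"
  proof cases
    case 1
    with z show ?thesis
      by (simp add: vec_eq_iff forall_3 s_def t_def x_def y_def chart_coords_def slope_pair_def
          slope_start_def slope_step_def pa wa algebra_simps power2_eq_square)
  next
    case 2
    \<comment> \<open>In chart 2 the cone equation reads a b = 1, so multiplying by b inverts the
      change from x_2 to the coordinate s = x_1; the differential of this relation handles the
      vectors.\<close>
    define a b da db where "a = p $ Inr 1" and "b = p $ Inr 3" and "da = w $ Inr 1" and "db = w $ Inr 3"
    have ab: "a * b = 1" "a * db + b * da = 0" using z 2 by (simp_all add: a_def b_def da_def db_def)
    have st: "s = r * a" "t = b" "x = dr * a + r * da" "y = db"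
      using 2 by (simp_all add: s_def t_def x_def y_def chart_coords_def pa wa a_def b_def da_def db_def)
    have slope: "slope_pair i b = (1, b)" "slope_step i = (0, 1)"
      using 2 by (simp_all add: slope_pair_def slope_start_def slope_step_def)
    have comp: "base_pt p $ 1 = r * a" "base_pt p $ 2 = r" "base_pt p $ 3 = r * b"
      "base_pt w $ 1 = dr * a + r * da" "base_pt w $ 2 = dr" "base_pt w $ 3 = dr * b + r * db"
      using z 2 by (simp_all add: pa wa a_def b_def da_def db_def)
    show ?thesis
      unfolding vec_eq_iff forall_3 st slope vector_add_component vector_smult_component
        cone_param_nth cone_param_deriv_nth fst_conv snd_conv comp
        one_power2 mult_1_left mult_1_right mult_zero_right
      using ab by (intro conjI) algebra+
  next
    case 3
    with z show ?thesis
      by (simp add: vec_eq_iff forall_3 s_def t_def x_def y_def chart_coords_def slope_pair_def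
          slope_start_def slope_step_def pa wa algebra_simps power2_eq_square)
  qed
  then show "base_pt p = s *s cone_param (slope_pair i t)"
    and "base_pt w = x *s cone_param (slope_pair i t) + (s * y) *s cone_param_deriv (slope_pair i t) (slope_step i)"
    by blast+
qed

section \<open>Gluing the chart expressions across the exceptional curve\<close>

context A1_neighbourhood
begin

text \<open>Away from the exceptional curve every chart expression computes \<omega> at
  (\<open>base_pt p\<close>, \<open>base_pt w\<close>), and chart changes preserve these two
  vectors, so the expressions agree. Continuity extends the agreement to the curve.\<close>

lemma vanishing_pullback_extends:
  assumes eta: "regular_sym_diff m (X - {0}) \<eta>"
    and om: "sym_diff_eq (X - {0}) \<omega> (\<lambda>p v. h p ^ (m div 2) * \<eta> p v)"
    and h: "h = (\<lambda>x. \<Sum>i\<in>UNIV. c $ i * x $ i)"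
  shows "pullback_extends m X \<omega>"
proof -
  have "\<forall>i. \<exists>ND. (\<forall>j s t. s *s cone_param (slope_pair i t) \<in> X \<longrightarrow> eval2 (snd ND j) (s, t) \<noteq> 0) \<and>
    (\<forall>s t x y. s *s cone_param (slope_pair i t) \<in> X - {0} \<longrightarrow>
       \<omega> (s *s cone_param (slope_pair i t))
         (x *s cone_param (slope_pair i t) + (s * y) *s cone_param_deriv (slope_pair i t) (slope_step i)) =
       (\<Sum>j\<le>m. eval2 (fst ND j) (s, t) / eval2 (snd ND j) (s, t) * x ^ j * y ^ (m - j)))"
    (is "\<forall>i. \<exists>ND. ?P i ND")
  proof
    fix i
    show "\<exists>ND. ?P i ND"
      unfolding slope_pair_def
    proof (rule vanishing_chart_form[OF eta om h, of "fst (slope_start i)" "fst (slope_step i)"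
          "snd (slope_start i)" "snd (slope_step i)"], goal_cases)
      case (1 N D)
      then show ?case unfolding prod.collapse by (intro exI[of _ "(N, D)"]) simp
    qed
  qed
  from choice[OF this] obtain ND where ND: "\<And>i. ?P i (ND i)" by blast
  define N D where "N i = fst (ND i)" and "D i = snd (ND i)" for i
  have nz: "eval2 (D i j) (s, t) \<noteq> 0" if "s *s cone_param (slope_pair i t) \<in> X" for i j s t
    using ND that unfolding D_def by blast
  have form: "\<omega> (s *s cone_param (slope_pair i t))
         (x *s cone_param (slope_pair i t) + (s * y) *s cone_param_deriv (slope_pair i t) (slope_step i)) =
       (\<Sum>j\<le>m. eval2 (N i j) (s, t) / eval2 (D i j) (s, t) * x ^ j * y ^ (m - j))"
    if "s *s cone_param (slope_pair i t) \<in> X - {0}" for i s t x y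
    using ND that unfolding N_def D_def by blast
  define E :: "3 \<Rightarrow> (3 + 3) sym_diff" where
    "E i p w = (\<Sum>j\<le>m. eval2 (N i j) (chart_coords i p) / eval2 (D i j) (chart_coords i p) *
       fst (chart_coords i w) ^ j * snd (chart_coords i w) ^ (m - j))" for i p w
  have Dnz: "eval2 (D i j) (chart_coords i p) \<noteq> 0"
    if "chart_tangent i p w" "base_pt p \<in> X" for i j p w
    using nz[of "fst (chart_coords i p)" i "snd (chart_coords i p)"] chart_coords_param(1)[OF that(1)] that(2)
    by simp
  have agree: "E i p w = \<omega> (base_pt p) (base_pt w)"
    if "chart_tangent i p w" "base_pt p \<in> X - {0}" for i p w
  proof -
    note param = chart_coords_param[OF that(1)]
    show ?thesis
      using form[of "fst (chart_coords i p)" i "snd (chart_coords i p)"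
          "fst (chart_coords i w)" "snd (chart_coords i w)"] that(2)
      unfolding param E_def by simp
  qed
  have cont: "((\<lambda>e. E i (f e) (g e)) \<longlongrightarrow> E i p w) F"
    if "(f \<longlongrightarrow> p) F" "(g \<longlongrightarrow> w) F" "chart_tangent i p w" "base_pt p \<in> X" for i p w F
      and f g :: "complex \<Rightarrow> complex ^ (3 + 3)"
    unfolding E_def using that(1,2) Dnz[OF that(3,4)] by (intro tendsto_intros)
  have cone: "X \<subseteq> quadric_cone" using X_subset_cone by blast
  have chartX: "base_pt p \<in> X" if "p \<in> blowup_chart X i" for p i
    using that by (simp add: blowup_chart_def)
  have tan: "chart_tangent i p w"
    if "p \<in> blowup_chart X i" "w \<in> tangent_space S p" "S \<subseteq> blowup_chart X i" for i p w S
    using chart_tangent_blowup_chart[OF cone that(1)] tangent_space_mono[OF that(3)] that(2) by blast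
  have regular: "regular_sym_diff m (blowup_chart X i) (E i)" for i
  proof -
    have "regular_on (blowup_chart X i) (\<lambda>p. eval2 (N i j) (chart_coords i p) / eval2 (D i j) (chart_coords i p))" for j
      unfolding regular_on_def
    proof (intro ballI exI conjI)
      fix p q
      show "zariski_open UNIV" by (rule zariski_open_UNIV)
      show "poly_fun (\<lambda>p. eval2 (N i j) (chart_coords i p))" "poly_fun (\<lambda>p. eval2 (D i j) (chart_coords i p))"
        unfolding chart_coords_def by (intro poly_fun_eval2 poly_fun.coord)+
      assume "q \<in> blowup_chart X i \<inter> UNIV"
      then have "q \<in> blowup_chart X i" by simp
      then show "eval2 (D i j) (chart_coords i q) \<noteq> 0"
        using Dnz tan[OF _ zero_in_tangent_space subset_refl] chartX by blast
    qed simp_all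
    then show ?thesis
      unfolding E_def chart_coords_def fst_conv snd_conv
      by (intro regular_sym_diff_binary) auto
  qed
  have glue: "E i p w = pullback (chart_change j) (E j) p w"
    if p: "p \<in> blowup_chart X i" "direction p $ j \<noteq> 0"
      and w: "w \<in> tangent_space {p \<in> blowup_chart X i. direction p $ j \<noteq> 0} p" for i j p w
  proof -
    have T: "chart_tangent i p w" using tan[OF p(1) w] by blast
    have pX: "base_pt p \<in> X" using p chartX by blast
    have "frechet_derivative (chart_change j) (at p) = chart_change_deriv j p"
      using frechet_derivative_at[OF chart_change_has_derivative[OF p(2)]] by simp
    then have pb: "pullback (chart_change j) (E j) p w = E j (chart_change j p) (chart_change_deriv j p w)"
      by (simp add: pullback_def)
    have base: "base_pt (chart_change j q) = base_pt q" "base_pt (chart_change_deriv j q v) = base_pt v" for q v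
      by (simp_all add: chart_change_def chart_change_deriv_def)
    have away: "E i q v = E j (chart_change j q) (chart_change_deriv j q v)"
      if "chart_tangent i q v" "direction q $ j \<noteq> 0" "base_pt q \<in> X - {0}" for q v
      using agree[OF that(1,3)] agree[OF chart_tangent_chart_change[OF that(1,2)]] that(3)
      unfolding base by simp
    show ?thesis
    proof (cases "base_pt p = 0")
      case False
      then show ?thesis using away[OF T p(2)] pX pb by simp
    next
      case True
      define z dz where "z = direction p" and "dz = direction w"
      \<comment> \<open>Approach the point of the exceptional curve along its normal line, where \<open>away\<close> applies.\<close>
      define f g where "f e = pair_vec (e *s z) z" and "g e = pair_vec (base_pt w + e *s dz) dz" for e
      have f: "(f \<longlongrightarrow> p) (at 0)"
      proof -
        have "(f \<longlongrightarrow> pair_vec (0 *s z) z) (at 0)"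
          unfolding f_def by (intro tendsto_intros)
        then show ?thesis using pair_vec_base_direction[of p] True by (simp add: z_def)
      qed
      have g: "(g \<longlongrightarrow> w) (at 0)"
      proof -
        have "(g \<longlongrightarrow> pair_vec (base_pt w + 0 *s dz) dz) (at 0)"
          unfolding g_def by (intro tendsto_intros)
        then show ?thesis using pair_vec_base_direction[of w] by (simp add: dz_def)
      qed
      have zi: "z $ i = 1" "dz $ i = 0" "z \<in> quadric_cone"
        using T unfolding chart_tangent_def z_def dz_def by blast+
      \<comment> \<open>The summand \<open>e *s dz\<close> in \<open>g\<close> is forced: it is the
        term x_i dz of the differential of x = x_i z at \<open>f e\<close>, where x_i = e.\<close>
      have Tfg: "chart_tangent i (f e) (g e)" for e
        using T True unfolding chart_tangent_def f_def g_def base_pt_pair_vec direction_pair_vec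
          z_def[symmetric] dz_def[symmetric]
        by (simp del: base_pt_nth)
      \<comment> \<open>The direction is constant along the curve, so both images are affine in e
        and their limits need no continuity of division.\<close>
      have cc: "chart_change j (f e) = pair_vec (e *s z) ((1 / z $ j) *s z)"
        "chart_change_deriv j (f e) (g e) =
           pair_vec (base_pt w + e *s dz) ((1 / z $ j) *s dz - (dz $ j / (z $ j)\<^sup>2) *s z)" for e
        unfolding chart_change_def chart_change_deriv_def f_def g_def
          base_pt_pair_vec direction_pair_vec by (rule refl)+
      have "((\<lambda>e. chart_change j (f e)) \<longlongrightarrow> pair_vec (0 *s z) ((1 / z $ j) *s z)) (at 0)"
        unfolding cc by (intro tendsto_intros)
      then have ccf: "((\<lambda>e. chart_change j (f e)) \<longlongrightarrow> chart_change j p) (at 0)"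
        using True by (simp add: chart_change_def z_def)
      have "((\<lambda>e. chart_change_deriv j (f e) (g e)) \<longlongrightarrow>
          pair_vec (base_pt w + 0 *s dz) ((1 / z $ j) *s dz - (dz $ j / (z $ j)\<^sup>2) *s z)) (at 0)"
        unfolding cc by (intro tendsto_intros)
      then have ccg: "((\<lambda>e. chart_change_deriv j (f e) (g e)) \<longlongrightarrow> chart_change_deriv j p w) (at 0)"
        by (simp add: chart_change_deriv_def z_def dz_def)
      have "((\<lambda>e. e *s z) \<longlongrightarrow> 0) (at 0)"
        by (intro tendsto_eq_intros) auto
      then have "\<forall>\<^sub>F e in at 0. e *s z \<in> X"
        by (rule X_relatively_open[OF _ zero_in_X])
          (use zi(3) in \<open>simp add: quadric_cone_def power2_eq_square\<close>)
      moreover have "\<forall>\<^sub>F e in at 0. e \<noteq> (0 :: complex)"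
        by (simp add: eventually_at_filter)
      ultimately have ev: "\<forall>\<^sub>F e in at 0. E i (f e) (g e) = E j (chart_change j (f e)) (chart_change_deriv j (f e) (g e))"
      proof eventually_elim
        case (elim e)
        have "e *s z \<noteq> 0" using elim(2) zi(1) by (auto simp: vec_eq_iff intro!: exI[of _ i])
        then show ?case
          using elim(1) p(2) by (intro away Tfg) (simp_all add: f_def z_def del: base_pt_nth direction_nth)
      qed
      have "((\<lambda>e. E j (chart_change j (f e)) (chart_change_deriv j (f e) (g e))) \<longlongrightarrow> E i p w) (at 0)"
        by (rule Lim_transform_eventually[OF cont[OF f g T pX] ev])
      moreover have "((\<lambda>e. E j (chart_change j (f e)) (chart_change_deriv j (f e) (g e))) \<longlongrightarrow>
          E j (chart_change j p) (chart_change_deriv j p w)) (at 0)"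
        using chart_tangent_chart_change[OF T p(2)] pX
        by (intro cont ccf ccg) (simp_all add: base)
      ultimately have "E i p w = E j (chart_change j p) (chart_change_deriv j p w)"
        by (intro tendsto_unique[OF at_neq_bot])
      then show ?thesis by (simp add: pb)
    qed
  qed
  show ?thesis
    unfolding pullback_extends_def blowup_sym_diff_def sym_diff_eq_def
  proof (intro exI[of _ E] conjI allI ballI)
    fix i p w
    assume p: "p \<in> blowup_chart X i - exceptional_chart X i"
      and w: "w \<in> tangent_space (blowup_chart X i - exceptional_chart X i) p"
    have "chart_tangent i p w" using tan[OF _ w] p by blast
    moreover have "base_pt p \<in> X - {0}"
      using p chartX by (auto simp: exceptional_chart_def)
    ultimately show "E i p w = pullback base_pt \<omega> p w"
      using agree by (simp add: pullback_def frechet_derivative_base_pt)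
  qed (use regular glue in auto)
qed

end

theorem corollary3p4:
  fixes X H :: "(complex ^ 3) set"
    and h :: "complex ^ 3 \<Rightarrow> complex"
    and m :: nat
    and \<omega> :: "3 sym_diff"
  assumes "A1_singularity X"
    and "m \<ge> 1"
    and "hyperplane_equation h" and "H = {x \<in> X. h x = 0}" and "0 \<in> H"
    and "sym_diff_vanishing m (X - {0}) h (m div 2) \<omega>"
  shows "pullback_extends m X \<omega>"
proof -
  interpret A1_neighbourhood X by standard (rule assms)
  obtain c d where "h = (\<lambda>x. (\<Sum>i\<in>UNIV. c $ i * x $ i) + d)"
    using assms(3) unfolding hyperplane_equation_def by blast
  moreover have "h 0 = 0" using assms(4,5) by simp
  ultimately have "h = (\<lambda>x. \<Sum>i\<in>UNIV. c $ i * x $ i)" by simp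
  moreover obtain \<eta> where "regular_sym_diff m (X - {0}) \<eta>"
    "sym_diff_eq (X - {0}) \<omega> (\<lambda>p v. h p ^ (m div 2) * \<eta> p v)"
    using assms(6) unfolding sym_diff_vanishing_def by blast
  ultimately show ?thesis by (intro vanishing_pullback_extends)
qed

end
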